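(* Let $r,s\in\mathbb{C}^*$ be roots of unity with $r^2\neq s^2$. There is a one-to-one correspondence between the simple $X_1$-torsionfree $\mathcal{B}$-modules and the simple $X_1$-torsionfree $U^+_{r,s}(B_2)$-modules.
   Context: $U^+_{r,s}(B_2)$ is the unital associative $\mathbb{C}$-algebra generated by $e_1,e_2$ subject to $$e_1^2 e_2-(r^2+s^2)e_1e_2e_1+r^2s^2e_2e_1^2=0,$$ $$e_1e_2^3-(r^2+rs+s^2)e_2e_1e_2^2+rs(r^2+rs+s^2)e_2^2e_1e_2-r^3s^3e_2^3e_1=0.$$ Put $X_1=e_1$, $X_2=e_1e_2-r^2e_2e_1$, $X_3=e_2X_2-s^{-2}X_2e_2$, $X_4=e_2$. These satisfy $$X_1X_2=s^2X_2X_1,\quad X_1X_3=r^2s^2X_3X_1,\quad X_1X_4=r^2X_4X_1+X_2,$$ $$X_2X_3=rsX_3X_2,\quad X_2X_4=s^2X_4X_2-s^2X_3,\quad X_3X_4=rsX_4X_3,$$ and the monomials $X_1^aX_2^bX_3^cX_4^d$ ($a,b,c,d\ge 0$) form a basis. Let $\tilde W=X_2+(r^2-s^2)X_4X_1$ and let $\mathcal{B}$ be the subalgebra of $U^+_{r,s}(B_2)$ generated by $X_1,X_2,X_3,\tilde W$. All modules are right modules. A module is $X_1$-torsionfree if no nonzero vector is annihilated by a power of $X_1$. *)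

theory Defs
  imports Complex_Main "HOL-Library.Poly_Mapping" "HOL-Algebra.QuotRing" "HOL-Algebra.Generated_Rings"
begin

section \<open>The free algebra on two generators\<close>

datatype gen = E1 | E2

text \<open>Words form a monoid under concatenation. It is written additively because the convolution
  product of \<^typ>\<open>'a \<Rightarrow>\<^sub>0 'b\<close> is defined for exponents in \<^class>\<open>monoid_add\<close>, which is not required
  to be commutative. Hence finitely supported functions on words form the free
  associative unital algebra.\<close>

datatype gen_word = Word (letters: "gen list")

instantiation gen_word :: monoid_add
begin

definition zero_gen_word :: gen_word where "0 = Word []"

definition plus_gen_word :: "gen_word \<Rightarrow> gen_word \<Rightarrow> gen_word"
  where "v + w = Word (letters v @ letters w)"

instance
  by standard (simp_all add: zero_gen_word_def plus_gen_word_def)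

end

type_synonym free_alg = "gen_word \<Rightarrow>\<^sub>0 complex"

definition e1 :: free_alg where "e1 = Poly_Mapping.single (Word [E1]) 1"

definition e2 :: free_alg where "e2 = Poly_Mapping.single (Word [E2]) 1"

definition scal :: "complex \<Rightarrow> free_alg" where "scal c = Poly_Mapping.single 0 c"

definition free_ring :: "free_alg ring" where
  "free_ring = \<lparr>carrier = UNIV, monoid.mult = (*), one = 1, ring.zero = 0, add = (+)\<rparr>"


section \<open>The algebra \<open>U\<^sup>+\<^sub>r\<^sub>,\<^sub>s(B\<^sub>2)\<close> and its subalgebra \<open>\<B>\<close>\<close>

definition serre1 :: "complex \<Rightarrow> complex \<Rightarrow> free_alg" where
  "serre1 r s = e1^2 * e2 - scal (r^2 + s^2) * e1 * e2 * e1 + scal (r^2 * s^2) * e2 * e1^2"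

definition serre2 :: "complex \<Rightarrow> complex \<Rightarrow> free_alg" where
  "serre2 r s = e1 * e2^3 - scal (r^2 + r * s + s^2) * e2 * e1 * e2^2
     + scal (r * s * (r^2 + r * s + s^2)) * e2^2 * e1 * e2 - scal (r^3 * s^3) * e2^3 * e1"

text \<open>The two-sided ideal of relations; \<^const>\<open>genideal\<close> and \<^const>\<open>FactRing\<close> do not
  presuppose commutativity.\<close>

definition rel_ideal :: "complex \<Rightarrow> complex \<Rightarrow> free_alg set" where
  "rel_ideal r s = genideal free_ring {serre1 r s, serre2 r s}"

definition Uplus :: "complex \<Rightarrow> complex \<Rightarrow> free_alg set ring" where
  "Uplus r s = free_ring Quot rel_ideal r s"

definition proj :: "complex \<Rightarrow> complex \<Rightarrow> free_alg \<Rightarrow> free_alg set" where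
  "proj r s a = rel_ideal r s +>\<^bsub>free_ring\<^esub> a"

definition x2 :: "complex \<Rightarrow> free_alg" where
  "x2 r = e1 * e2 - scal (r^2) * e2 * e1"

definition x3 :: "complex \<Rightarrow> complex \<Rightarrow> free_alg" where
  "x3 r s = e2 * x2 r - scal (inverse (s^2)) * x2 r * e2"

definition X1 :: "complex \<Rightarrow> complex \<Rightarrow> free_alg set" where "X1 r s = proj r s e1"

definition X2 :: "complex \<Rightarrow> complex \<Rightarrow> free_alg set" where "X2 r s = proj r s (x2 r)"

definition X3 :: "complex \<Rightarrow> complex \<Rightarrow> free_alg set" where "X3 r s = proj r s (x3 r s)"

text \<open>\<open>X\<^sub>2 + (r\<^sup>2 - s\<^sup>2) X\<^sub>4 X\<^sub>1\<close>, where \<open>X\<^sub>4\<close> is the class of \<^const>\<open>e2\<close>.\<close>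

definition Wtilde :: "complex \<Rightarrow> complex \<Rightarrow> free_alg set" where
  "Wtilde r s = proj r s (x2 r + scal (r^2 - s^2) * e2 * e1)"

text \<open>A subring containing the image of the scalars is the same as a (unital) subalgebra.\<close>

definition Bsub :: "complex \<Rightarrow> complex \<Rightarrow> free_alg set ring" where
  "Bsub r s = (Uplus r s)\<lparr>carrier := generate_ring (Uplus r s)
     (range (\<lambda>c. proj r s (scal c)) \<union> {X1 r s, X2 r s, X3 r s, Wtilde r s})\<rparr>"


section \<open>Right modules over a not necessarily commutative ring\<close>

text \<open>As in \<^theory>\<open>HOL-Algebra.Module\<close>, the record extends \<^typ>\<open>'v ring\<close> only to
  reuse \<^const>\<open>abelian_group\<close>; the multiplicative fields play no role. Over a ring containing
  (an image of) the complex scalars, the vector space structure of a module is part of the action.\<close>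

record ('a, 'v) right_module = "'v ring" +
  ract :: "'v \<Rightarrow> 'a \<Rightarrow> 'v"  (infixl "\<triangleleft>\<index>" 70)

locale right_module = R?: ring R + M?: abelian_group M
  for R :: "('a, 'm) ring_scheme" (structure) and M :: "('a, 'v) right_module" (structure) +
  assumes ract_closed: "\<lbrakk>v \<in> carrier M; a \<in> carrier R\<rbrakk> \<Longrightarrow> v \<triangleleft>\<^bsub>M\<^esub> a \<in> carrier M"
    and ract_add_left: "\<lbrakk>v \<in> carrier M; w \<in> carrier M; a \<in> carrier R\<rbrakk>
      \<Longrightarrow> (v \<oplus>\<^bsub>M\<^esub> w) \<triangleleft>\<^bsub>M\<^esub> a = (v \<triangleleft>\<^bsub>M\<^esub> a) \<oplus>\<^bsub>M\<^esub> (w \<triangleleft>\<^bsub>M\<^esub> a)"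
    and ract_add_right: "\<lbrakk>v \<in> carrier M; a \<in> carrier R; b \<in> carrier R\<rbrakk>
      \<Longrightarrow> v \<triangleleft>\<^bsub>M\<^esub> (a \<oplus>\<^bsub>R\<^esub> b) = (v \<triangleleft>\<^bsub>M\<^esub> a) \<oplus>\<^bsub>M\<^esub> (v \<triangleleft>\<^bsub>M\<^esub> b)"
    and ract_mult: "\<lbrakk>v \<in> carrier M; a \<in> carrier R; b \<in> carrier R\<rbrakk>
      \<Longrightarrow> v \<triangleleft>\<^bsub>M\<^esub> (a \<otimes>\<^bsub>R\<^esub> b) = (v \<triangleleft>\<^bsub>M\<^esub> a) \<triangleleft>\<^bsub>M\<^esub> b"
    and ract_one: "v \<in> carrier M \<Longrightarrow> v \<triangleleft>\<^bsub>M\<^esub> \<one>\<^bsub>R\<^esub> = v"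

definition right_submodule ::
  "('a, 'm) ring_scheme \<Rightarrow> ('a, 'v) right_module \<Rightarrow> 'v set \<Rightarrow> bool" where
  "right_submodule R M N \<longleftrightarrow>
     additive_subgroup N M \<and> (\<forall>v\<in>N. \<forall>a\<in>carrier R. v \<triangleleft>\<^bsub>M\<^esub> a \<in> N)"

definition simple_right_module ::
  "('a, 'm) ring_scheme \<Rightarrow> ('a, 'v) right_module \<Rightarrow> bool" where
  "simple_right_module R M \<longleftrightarrow>
     right_module R M \<and> carrier M \<noteq> {\<zero>\<^bsub>M\<^esub>} \<and>
     (\<forall>N. right_submodule R M N \<longrightarrow> N = {\<zero>\<^bsub>M\<^esub>} \<or> N = carrier M)"

definition torsionfree_wrt ::
  "('a, 'm) ring_scheme \<Rightarrow> 'a \<Rightarrow> ('a, 'v) right_module \<Rightarrow> bool" where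
  "torsionfree_wrt R x M \<longleftrightarrow>
     (\<forall>v\<in>carrier M. \<forall>n::nat. v \<triangleleft>\<^bsub>M\<^esub> (x [^]\<^bsub>R\<^esub> n) = \<zero>\<^bsub>M\<^esub> \<longrightarrow> v = \<zero>\<^bsub>M\<^esub>)"

definition right_module_isomorphic ::
  "('a, 'm) ring_scheme \<Rightarrow> ('a, 'v) right_module \<Rightarrow> ('a, 'w) right_module \<Rightarrow> bool" where
  "right_module_isomorphic R M N \<longleftrightarrow>
     (\<exists>f. bij_betw f (carrier M) (carrier N) \<and>
       (\<forall>v\<in>carrier M. \<forall>w\<in>carrier M. f (v \<oplus>\<^bsub>M\<^esub> w) = f v \<oplus>\<^bsub>N\<^esub> f w) \<and>
       (\<forall>v\<in>carrier M. \<forall>a\<in>carrier R. f (v \<triangleleft>\<^bsub>M\<^esub> a) = f v \<triangleleft>\<^bsub>N\<^esub> a))"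

definition simple_tf ::
  "('a, 'm) ring_scheme \<Rightarrow> 'a \<Rightarrow> ('a, 'v) right_module set" where
  "simple_tf R x = {M. simple_right_module R M \<and> torsionfree_wrt R x M}"

text \<open>Isomorphism as an equivalence relation on \<^const>\<open>simple_tf\<close>, so that
  \<open>simple_tf R x // iso_rel R x\<close> is the set of isomorphism classes and
  \<open>iso_rel R x `` {M}\<close> is the class of \<open>M\<close>.\<close>

definition iso_rel ::
  "('a, 'm) ring_scheme \<Rightarrow> 'a \<Rightarrow> ('a, 'v) right_module rel" where
  "iso_rel R x = {(M, N). M \<in> simple_tf R x \<and> N \<in> simple_tf R x \<and> right_module_isomorphic R M N}"

text \<open>All axioms above quantify over \<open>carrier R\<close> only, and \<^const>\<open>Bsub\<close> has the same underlying
  type as \<^const>\<open>Uplus\<close>. Restricting a \<^const>\<open>Uplus\<close>-module to \<^const>\<open>Bsub\<close> therefore leaves the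
  record unchanged: \<open>iso_rel (Bsub r s) x `` {M}\<close> is the class of the restriction of \<open>M\<close>.\<close>

end

theory Submission
  imports Defs "HOL-Library.Countable" "HOL-Analysis.Continuum_Not_Denumerable"
    "HOL-Computational_Algebra.Fundamental_Theorem_Algebra"
begin

text \<open>The element \<open>X\<^sub>1\<close> is normal in \<open>\<B>\<close>, and every \<open>u\<close> in \<open>U = U\<^sup>+\<^sub>r\<^sub>,\<^sub>s(B\<^sub>2)\<close> satisfies \<open>u X\<^sub>1\<^sup>k \<in> \<B>\<close>
  for some \<open>k\<close>, because with \<open>W\<close> for the generator \<^const>\<open>Wtilde\<close>,
  \<open>(r\<^sup>2 - s\<^sup>2) X\<^sub>4 X\<^sub>1 = W - X\<^sub>2\<close>; so \<open>\<B>\<close> and \<open>U\<close> agree once \<open>X\<^sub>1\<close> is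
  inverted. By normality, \<open>X\<^sub>1\<close> acts bijectively on a simple \<open>X\<^sub>1\<close>-torsionfree \<open>\<B>\<close>-module, and
  \<open>v \<cdot> u = (v \<cdot> (u X\<^sub>1\<^sup>k)) X\<^sub>1\<^sup>-\<^sup>k\<close> extends the action to \<open>U\<close>. Conversely, a suitable power \<open>X\<^sub>1\<^sup>n\<close>
  commutes with the action of \<open>U\<close> on a simple torsionfree module. As \<open>U\<close> has countable dimension
  over \<open>\<complex>\<close>, it acts by a nonzero scalar (Amitsur's form of Schur's lemma); hence
  \<open>X\<^sub>1\<^sup>-\<^sup>1\<close> acts as an element of \<open>\<B>\<close>, so \<open>\<B>\<close>-submodules are \<open>U\<close>-submodules.\<close>


section \<open>Right modules\<close>

context right_module
begin

lemma ract_zero_left: "\<zero>\<^bsub>M\<^esub> \<triangleleft>\<^bsub>M\<^esub> a = \<zero>\<^bsub>M\<^esub>" if a: "a \<in> carrier R"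
  using ract_add_left[of "\<zero>\<^bsub>M\<^esub>" "\<zero>\<^bsub>M\<^esub>" a] ract_closed[of "\<zero>\<^bsub>M\<^esub>" a] a M.add.r_cancel_one'
  by fastforce

lemma ract_zero_right: "v \<triangleleft>\<^bsub>M\<^esub> \<zero>\<^bsub>R\<^esub> = \<zero>\<^bsub>M\<^esub>" if v: "v \<in> carrier M"
  using ract_add_right[of v "\<zero>\<^bsub>R\<^esub>" "\<zero>\<^bsub>R\<^esub>"] ract_closed[of v "\<zero>\<^bsub>R\<^esub>"] v M.add.r_cancel_one'
  by fastforce

lemma ract_minus_left: "(\<ominus>\<^bsub>M\<^esub> v) \<triangleleft>\<^bsub>M\<^esub> a = \<ominus>\<^bsub>M\<^esub> (v \<triangleleft>\<^bsub>M\<^esub> a)"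
  if "v \<in> carrier M" "a \<in> carrier R"
  using ract_add_left[of "\<ominus>\<^bsub>M\<^esub> v" v a] that
  by (intro M.minus_equality[symmetric]) (auto simp: ract_closed ract_zero_left M.l_neg)

lemma ract_minus_right: "v \<triangleleft>\<^bsub>M\<^esub> (\<ominus>\<^bsub>R\<^esub> a) = \<ominus>\<^bsub>M\<^esub> (v \<triangleleft>\<^bsub>M\<^esub> a)"
  if "v \<in> carrier M" "a \<in> carrier R"
  using ract_add_right[of v "\<ominus>\<^bsub>R\<^esub> a" a] that
  by (intro M.minus_equality[symmetric]) (auto simp: ract_closed ract_zero_right R.l_neg)

lemma restrict_subring:
  assumes "subring C R"
  shows "right_module (R\<lparr>carrier := C\<rparr>) M"
proof -
  have "C \<subseteq> carrier R"
    using assms by (simp add: subringE(1))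
  moreover have "ring (R\<lparr>carrier := C\<rparr>)"
    by (rule R.subring_is_ring[OF assms])
  ultimately show ?thesis
    by (intro right_module.intro right_module_axioms.intro M.abelian_group_axioms)
      (auto simp: subset_iff ract_closed ract_add_left ract_add_right ract_mult ract_one)
qed

text \<open>Negatives come from the action of \<open>-1\<close>.\<close>

lemma right_submoduleI:
  assumes "N \<subseteq> carrier M" and "\<zero>\<^bsub>M\<^esub> \<in> N"
    and "\<And>v w. v \<in> N \<Longrightarrow> w \<in> N \<Longrightarrow> v \<oplus>\<^bsub>M\<^esub> w \<in> N"
    and ract: "\<And>v a. v \<in> N \<Longrightarrow> a \<in> carrier R \<Longrightarrow> v \<triangleleft>\<^bsub>M\<^esub> a \<in> N"
  shows "right_submodule R M N"
proof -
  have "\<ominus>\<^bsub>M\<^esub> v \<in> N" if "v \<in> N" for v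
  proof -
    have "v \<in> carrier M"
      using that assms(1) by blast
    then show ?thesis
      using ract[OF that, of "\<ominus>\<^bsub>R\<^esub> \<one>\<^bsub>R\<^esub>"] by (simp add: ract_minus_right ract_one)
  qed
  then have "subgroup N (add_monoid M)"
    using assms by (intro M.add.subgroupI) (auto simp: a_inv_def)
  then show ?thesis
    by (simp add: right_submodule_def additive_subgroupI ract)
qed

text \<open>If \<open>v z = 0\<close>, then \<open>(v a) z = v (a z) = (v z) a' = 0\<close>.
  Commutation is asked only of the action, because the element met in Schur's lemma below is known
  to commute with the ring only as far as \<open>M\<close> can see.\<close>

lemma kernel_submodule:
  assumes z: "z \<in> carrier R"
    and comm: "\<And>v a. v \<in> carrier M \<Longrightarrow> a \<in> carrier R \<Longrightarrow>
      \<exists>a'\<in>carrier R. v \<triangleleft>\<^bsub>M\<^esub> (a \<otimes>\<^bsub>R\<^esub> z) = v \<triangleleft>\<^bsub>M\<^esub> (z \<otimes>\<^bsub>R\<^esub> a')"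
  shows "right_submodule R M {v \<in> carrier M. v \<triangleleft>\<^bsub>M\<^esub> z = \<zero>\<^bsub>M\<^esub>}"
proof (rule right_submoduleI)
  fix v a
  assume v: "v \<in> {v \<in> carrier M. v \<triangleleft>\<^bsub>M\<^esub> z = \<zero>\<^bsub>M\<^esub>}" and a: "a \<in> carrier R"
  then obtain a' where "a' \<in> carrier R" "v \<triangleleft>\<^bsub>M\<^esub> (a \<otimes>\<^bsub>R\<^esub> z) = v \<triangleleft>\<^bsub>M\<^esub> (z \<otimes>\<^bsub>R\<^esub> a')"
    using comm by blast
  then show "v \<triangleleft>\<^bsub>M\<^esub> a \<in> {v \<in> carrier M. v \<triangleleft>\<^bsub>M\<^esub> z = \<zero>\<^bsub>M\<^esub>}"
    using v a z by (simp add: ract_mult ract_closed ract_zero_left)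
qed (use z in \<open>auto simp: ract_zero_left ract_add_left\<close>)

text \<open>Here \<open>(v z) a = v (z a) = (v a') z\<close>. This serves both a normal element and
  an element whose action commutes with that of the ring.\<close>

lemma image_submodule:
  assumes z: "z \<in> carrier R"
    and comm: "\<And>v a. v \<in> carrier M \<Longrightarrow> a \<in> carrier R \<Longrightarrow>
      \<exists>a'\<in>carrier R. v \<triangleleft>\<^bsub>M\<^esub> (z \<otimes>\<^bsub>R\<^esub> a) = v \<triangleleft>\<^bsub>M\<^esub> (a' \<otimes>\<^bsub>R\<^esub> z)"
  shows "right_submodule R M ((\<lambda>v. v \<triangleleft>\<^bsub>M\<^esub> z) ` carrier M)"
proof (rule right_submoduleI)
  show "\<zero>\<^bsub>M\<^esub> \<in> (\<lambda>v. v \<triangleleft>\<^bsub>M\<^esub> z) ` carrier M"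
    using z by (intro image_eqI[of _ _ "\<zero>\<^bsub>M\<^esub>"]) (auto simp: ract_zero_left)
next
  fix v w
  assume "v \<in> (\<lambda>v. v \<triangleleft>\<^bsub>M\<^esub> z) ` carrier M" "w \<in> (\<lambda>v. v \<triangleleft>\<^bsub>M\<^esub> z) ` carrier M"
  then show "v \<oplus>\<^bsub>M\<^esub> w \<in> (\<lambda>v. v \<triangleleft>\<^bsub>M\<^esub> z) ` carrier M"
    using z by (auto simp: ract_add_left[symmetric])
next
  fix w a
  assume "w \<in> (\<lambda>v. v \<triangleleft>\<^bsub>M\<^esub> z) ` carrier M" and a: "a \<in> carrier R"
  then obtain v where v: "v \<in> carrier M" "w = v \<triangleleft>\<^bsub>M\<^esub> z"
    by blast
  then obtain a' where a': "a' \<in> carrier R" "v \<triangleleft>\<^bsub>M\<^esub> (z \<otimes>\<^bsub>R\<^esub> a) = v \<triangleleft>\<^bsub>M\<^esub> (a' \<otimes>\<^bsub>R\<^esub> z)"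
    using comm a by blast
  then have "w \<triangleleft>\<^bsub>M\<^esub> a = (v \<triangleleft>\<^bsub>M\<^esub> a') \<triangleleft>\<^bsub>M\<^esub> z"
    using v a z by (simp add: ract_mult)
  then show "w \<triangleleft>\<^bsub>M\<^esub> a \<in> (\<lambda>v. v \<triangleleft>\<^bsub>M\<^esub> z) ` carrier M"
    using v a' by (auto simp: ract_closed)
qed (use z in \<open>auto simp: ract_closed\<close>)

lemma inj_on_ractI:
  assumes z: "z \<in> carrier R"
    and "\<And>v. v \<in> carrier M \<Longrightarrow> v \<triangleleft>\<^bsub>M\<^esub> z = \<zero>\<^bsub>M\<^esub> \<Longrightarrow> v = \<zero>\<^bsub>M\<^esub>"
  shows "inj_on (\<lambda>v. v \<triangleleft>\<^bsub>M\<^esub> z) (carrier M)"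
proof (rule inj_onI)
  fix v w
  assume vw: "v \<in> carrier M" "w \<in> carrier M" "v \<triangleleft>\<^bsub>M\<^esub> z = w \<triangleleft>\<^bsub>M\<^esub> z"
  then have "(v \<oplus>\<^bsub>M\<^esub> (\<ominus>\<^bsub>M\<^esub> w)) \<triangleleft>\<^bsub>M\<^esub> z = \<zero>\<^bsub>M\<^esub>"
    using z by (simp add: ract_add_left ract_minus_left ract_closed M.r_neg)
  then have "v \<oplus>\<^bsub>M\<^esub> (\<ominus>\<^bsub>M\<^esub> w) = \<zero>\<^bsub>M\<^esub>"
    using assms(2)[of "v \<oplus>\<^bsub>M\<^esub> (\<ominus>\<^bsub>M\<^esub> w)"] vw by auto
  then show "v = w"
    using vw M.minus_equality M.minus_minus M.minus_closed by (metis M.add.inv_closed)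
qed

lemma ract_cancel:
  assumes "torsionfree_wrt R x M" "x \<in> carrier R" "v \<in> carrier M" "w \<in> carrier M"
    and "v \<triangleleft>\<^bsub>M\<^esub> (x [^]\<^bsub>R\<^esub> (k::nat)) = w \<triangleleft>\<^bsub>M\<^esub> (x [^]\<^bsub>R\<^esub> k)"
  shows "v = w"
proof -
  have "inj_on (\<lambda>v. v \<triangleleft>\<^bsub>M\<^esub> (x [^]\<^bsub>R\<^esub> k)) (carrier M)"
    using assms(1,2) by (intro inj_on_ractI R.nat_pow_closed) (auto simp: torsionfree_wrt_def)
  then show ?thesis
    using assms by (simp add: inj_onD)
qed

end

section \<open>Simple torsionfree modules and their isomorphism classes\<close>

lemma simple_tfD:
  assumes "M \<in> simple_tf R x"
  shows "right_module R M" "carrier M \<noteq> {\<zero>\<^bsub>M\<^esub>}" "torsionfree_wrt R x M"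
    and "\<And>N. right_submodule R M N \<Longrightarrow> N = {\<zero>\<^bsub>M\<^esub>} \<or> N = carrier M"
  using assms by (auto simp: simple_tf_def simple_right_module_def)

lemma right_module_isomorphic_refl: "right_module_isomorphic R M M"
  unfolding right_module_isomorphic_def by (rule exI[of _ "\<lambda>v. v"]) (auto simp: bij_betw_def)

lemma right_module_isomorphic_trans:
  assumes "right_module_isomorphic R M N" "right_module_isomorphic R N L"
  shows "right_module_isomorphic R M L"
proof -
  obtain f g where f: "bij_betw f (carrier M) (carrier N)"
     "\<forall>v\<in>carrier M. \<forall>w\<in>carrier M. f (v \<oplus>\<^bsub>M\<^esub> w) = f v \<oplus>\<^bsub>N\<^esub> f w"
     "\<forall>v\<in>carrier M. \<forall>a\<in>carrier R. f (v \<triangleleft>\<^bsub>M\<^esub> a) = f v \<triangleleft>\<^bsub>N\<^esub> a"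
    and g: "bij_betw g (carrier N) (carrier L)"
     "\<forall>v\<in>carrier N. \<forall>w\<in>carrier N. g (v \<oplus>\<^bsub>N\<^esub> w) = g v \<oplus>\<^bsub>L\<^esub> g w"
     "\<forall>v\<in>carrier N. \<forall>a\<in>carrier R. g (v \<triangleleft>\<^bsub>N\<^esub> a) = g v \<triangleleft>\<^bsub>L\<^esub> a"
    using assms unfolding right_module_isomorphic_def by blast
  then show ?thesis
    unfolding right_module_isomorphic_def
    by (intro exI[of _ "g \<circ> f"]) (auto simp: bij_betw_trans bij_betwE)
qed

lemma right_module_isomorphic_sym:
  assumes "right_module R M" and "right_module_isomorphic R M N"
  shows "right_module_isomorphic R N M"
proof -
  interpret M: right_module R M by fact
  obtain f where f: "bij_betw f (carrier M) (carrier N)"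
     "\<forall>v\<in>carrier M. \<forall>w\<in>carrier M. f (v \<oplus>\<^bsub>M\<^esub> w) = f v \<oplus>\<^bsub>N\<^esub> f w"
     "\<forall>v\<in>carrier M. \<forall>a\<in>carrier R. f (v \<triangleleft>\<^bsub>M\<^esub> a) = f v \<triangleleft>\<^bsub>N\<^esub> a"
    using assms unfolding right_module_isomorphic_def by blast
  define g where "g = inv_into (carrier M) f"
  have g: "bij_betw g (carrier N) (carrier M)"
    unfolding g_def by (rule bij_betw_inv_into[OF f(1)])
  have gf: "g (f v) = v" if "v \<in> carrier M" for v
    using f(1) that by (simp add: g_def bij_betw_inv_into_left)
  have ex: "\<exists>v\<in>carrier M. w = f v" if "w \<in> carrier N" for w
    using f(1) that by (auto simp: bij_betw_def)
  have "g (v \<oplus>\<^bsub>N\<^esub> w) = g v \<oplus>\<^bsub>M\<^esub> g w" if vw: "v \<in> carrier N" "w \<in> carrier N" for v w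
  proof -
    obtain v' w' where "v' \<in> carrier M" "w' \<in> carrier M" "v = f v'" "w = f w'"
      using ex vw by metis
    then show ?thesis
      using gf f(2) M.M.a_closed by metis
  qed
  moreover have "g (v \<triangleleft>\<^bsub>N\<^esub> a) = g v \<triangleleft>\<^bsub>M\<^esub> a" if v: "v \<in> carrier N" and a: "a \<in> carrier R" for v a
  proof -
    obtain v' where "v' \<in> carrier M" "v = f v'"
      using ex v by metis
    then show ?thesis
      using gf f(3) M.ract_closed a by metis
  qed
  ultimately show ?thesis
    unfolding right_module_isomorphic_def using g by blast
qed

lemma equiv_iso_rel: "equiv (simple_tf R x) (iso_rel R x)"
proof (rule equivI)
  show "refl_on (simple_tf R x) (iso_rel R x)"
    by (auto simp: refl_on_def iso_rel_def right_module_isomorphic_refl)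
  show "sym (iso_rel R x)"
    by (auto simp: sym_def iso_rel_def dest: simple_tfD(1) intro: right_module_isomorphic_sym)
  show "trans (iso_rel R x)"
    by (auto simp: trans_def iso_rel_def intro: right_module_isomorphic_trans)
qed (auto simp: iso_rel_def)

text \<open>Restriction of modules leaves the record unchanged, so the correspondence of classes
  reduces to an inclusion of sets: \<open>A\<close> will hold the modules over the large ring,
  \<open>B\<close> those over the subring, and \<open>onto\<close> says that each module over the
  subring is isomorphic to a restricted one.\<close>

lemma bij_betw_quotient_of_subset:
  assumes r: "equiv A r" and s: "equiv B s"
    and rs: "\<And>a b. a \<in> A \<Longrightarrow> b \<in> A \<Longrightarrow> (a, b) \<in> r \<longleftrightarrow> (a, b) \<in> s"
    and "A \<subseteq> B" and onto: "\<And>b. b \<in> B \<Longrightarrow> \<exists>a\<in>A. (a, b) \<in> s"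
  shows "\<exists>\<Phi>. bij_betw \<Phi> (A // r) (B // s) \<and> (\<forall>a\<in>A. \<Phi> (r `` {a}) = s `` {a})"
proof -
  \<comment> \<open>Saturating a class under \<open>s\<close> avoids the choice of a
    representative.\<close>
  define \<Phi> where "\<Phi> C = s `` C" for C
  have \<Phi>: "\<Phi> (r `` {a}) = s `` {a}" if a: "a \<in> A" for a
  proof -
    have "s `` {b} = s `` {a}" if "b \<in> r `` {a}" for b
      using that a r s rs by (metis Image_singleton_iff equiv_class_eq equiv_class_eq_iff)
    moreover have "a \<in> r `` {a}"
      using a r by (rule equiv_class_self[rotated])
    moreover have "s `` (r `` {a}) = (\<Union>b\<in>r `` {a}. s `` {b})"
      by blast
    ultimately show ?thesis
      unfolding \<Phi>_def by blast
  qed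
  have "inj_on \<Phi> (A // r)"
  proof (rule inj_onI)
    fix C D
    assume C: "C \<in> A // r" and D: "D \<in> A // r" and eq: "\<Phi> C = \<Phi> D"
    obtain a b where ab: "a \<in> A" "b \<in> A" "C = r `` {a}" "D = r `` {b}"
      using C D by (auto simp: quotient_def)
    then have "(a, b) \<in> s"
      using eq \<Phi> s \<open>A \<subseteq> B\<close> by (metis eq_equiv_class subsetD)
    then show "C = D"
      using ab rs r by (metis equiv_class_eq)
  qed
  moreover have "\<Phi> ` (A // r) = B // s"
  proof
    show "\<Phi> ` (A // r) \<subseteq> B // s"
      using \<Phi> \<open>A \<subseteq> B\<close> by (auto simp: quotient_def)
    show "B // s \<subseteq> \<Phi> ` (A // r)"
    proof
      fix D
      assume "D \<in> B // s"
      then obtain b where b: "b \<in> B" "D = s `` {b}"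
        by (auto simp: quotient_def)
      then obtain a where a: "a \<in> A" "(a, b) \<in> s"
        using onto by blast
      then have "D = \<Phi> (r `` {a})"
        using \<Phi> b s by (metis equiv_class_eq)
      then show "D \<in> \<Phi> ` (A // r)"
        using a by (auto simp: quotient_def)
    qed
  qed
  ultimately show ?thesis
    using \<Phi> by (auto simp: bij_betw_def)
qed


section \<open>Modules over a subring containing a normal denominator element\<close>

text \<open>This stands in for the Ore localisation at the powers of \<open>x\<close>. The ring of
  fractions is never formed: fractions are used only through modules on which \<open>x\<close> acts
  injectively.\<close>

locale ore_pair = ring R for R (structure) +
  fixes B x
  assumes subring_B: "subring B R" and x_in_B: "x \<in> B"
    and normal_left: "b \<in> B \<Longrightarrow> \<exists>b'\<in>B. x \<otimes> b = b' \<otimes> x"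
    and normal_right: "b \<in> B \<Longrightarrow> \<exists>b'\<in>B. b \<otimes> x = x \<otimes> b'"
    and denominator: "u \<in> carrier R \<Longrightarrow> \<exists>k::nat. u \<otimes> x [^] k \<in> B"
begin

abbreviation RB where "RB \<equiv> R\<lparr>carrier := B\<rparr>"

lemma B_carrier: "b \<in> B \<Longrightarrow> b \<in> carrier R"
  using subringE(1)[OF subring_B] by blast

lemmas B_closed = subringE(3,5,6,7)[OF subring_B]

lemma x_carrier: "x \<in> carrier R"
  using x_in_B B_carrier by blast

lemma pow_B: "x [^] (k::nat) \<in> B"
  by (induction k) (auto simp: B_closed x_in_B)

lemma pow_carrier: "x [^] (k::nat) \<in> carrier R"
  using pow_B B_carrier by blast

lemma normal_right_pow: "b \<in> B \<Longrightarrow> \<exists>b'\<in>B. b \<otimes> x [^] (k::nat) = x [^] k \<otimes> b'"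
proof (induction k)
  case 0
  then show ?case
    using B_carrier by auto
next
  case (Suc k)
  then obtain b' where b': "b' \<in> B" "b \<otimes> x [^] k = x [^] k \<otimes> b'"
    by blast
  obtain b'' where b'': "b'' \<in> B" "b' \<otimes> x = x \<otimes> b''"
    using normal_right[OF b'(1)] by blast
  have "b \<otimes> x [^] Suc k = x [^] k \<otimes> (b' \<otimes> x)"
    using b' Suc.prems B_carrier x_carrier by (simp add: m_assoc[symmetric])
  then show ?case
    using b'' B_carrier x_carrier by (auto simp: m_assoc)
qed

lemma denominator_add: "u \<otimes> x [^] (k::nat) \<in> B \<Longrightarrow> u \<in> carrier R \<Longrightarrow> u \<otimes> x [^] (k + l) \<in> B"
  using B_closed(3)[of "u \<otimes> x [^] k" "x [^] l"] x_carrier pow_B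
  by (simp add: m_assoc nat_pow_mult)

lemma denominator2:
  assumes "u \<in> carrier R" "u' \<in> carrier R"
  shows "\<exists>k::nat. u \<otimes> x [^] k \<in> B \<and> u' \<otimes> x [^] k \<in> B"
proof -
  obtain k l :: nat where "u \<otimes> x [^] k \<in> B" "u' \<otimes> x [^] l \<in> B"
    using assms denominator by blast
  then have "u \<otimes> x [^] (k + l) \<in> B" "u' \<otimes> x [^] (l + k) \<in> B"
    using denominator_add assms by blast+
  then show ?thesis
    by (auto simp: add.commute)
qed

lemma torsionfree_B: "torsionfree_wrt RB x M \<longleftrightarrow> torsionfree_wrt R x M"
  by (simp add: torsionfree_wrt_def nat_pow_consistent[symmetric])

end

section \<open>Extending the action from the subring to the whole ring\<close>

locale simple_tf_B = ore_pair +
  fixes N :: "('a, 'v) right_module"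
  assumes N: "N \<in> simple_tf RB x"
begin

sublocale N: right_module RB N
  by (rule simple_tfD(1)[OF N])

lemma torsionfree: "torsionfree_wrt R x N"
  using simple_tfD(3)[OF N] torsionfree_B by blast

text \<open>The image \<open>N x\<close> is a submodule because \<open>(v x) b = (v b') x\<close>
  when \<open>x b = b' x\<close>. It is nonzero by torsionfreeness, so simplicity makes it all of
  \<open>N\<close>.\<close>

lemma bij_ract_x: "bij_betw (\<lambda>v. v \<triangleleft>\<^bsub>N\<^esub> x) (carrier N) (carrier N)"
proof -
  have tf: "v = \<zero>\<^bsub>N\<^esub>" if "v \<in> carrier N" "v \<triangleleft>\<^bsub>N\<^esub> x = \<zero>\<^bsub>N\<^esub>" for v
  proof -
    have "v \<triangleleft>\<^bsub>N\<^esub> x [^] (1::nat) = \<zero>\<^bsub>N\<^esub>"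
      using that x_carrier by (simp only: nat_pow_eone)
    then show ?thesis
      using torsionfree that(1) unfolding torsionfree_wrt_def by blast
  qed
  then have "inj_on (\<lambda>v. v \<triangleleft>\<^bsub>N\<^esub> x) (carrier N)"
    by (intro N.inj_on_ractI) (auto simp: x_in_B)
  moreover have "right_submodule RB N ((\<lambda>v. v \<triangleleft>\<^bsub>N\<^esub> x) ` carrier N)"
    using normal_left by (intro N.image_submodule) (auto simp: x_in_B, metis)
  then have "(\<lambda>v. v \<triangleleft>\<^bsub>N\<^esub> x) ` carrier N = {\<zero>\<^bsub>N\<^esub>} \<or> (\<lambda>v. v \<triangleleft>\<^bsub>N\<^esub> x) ` carrier N = carrier N"
    by (rule simple_tfD(4)[OF N])
  moreover have "(\<lambda>v. v \<triangleleft>\<^bsub>N\<^esub> x) ` carrier N \<noteq> {\<zero>\<^bsub>N\<^esub>}"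
    using simple_tfD(2)[OF N] tf N.M.zero_closed by blast
  ultimately show ?thesis
    by (auto simp: bij_betw_def)
qed

lemma bij_ract_pow: "bij_betw (\<lambda>v. v \<triangleleft>\<^bsub>N\<^esub> x [^] (k::nat)) (carrier N) (carrier N)"
proof (induction k)
  case 0
  then show ?case
    using N.ract_one by (auto simp: bij_betw_def inj_on_def image_def)
next
  case (Suc k)
  have "bij_betw ((\<lambda>v. v \<triangleleft>\<^bsub>N\<^esub> x) \<circ> (\<lambda>v. v \<triangleleft>\<^bsub>N\<^esub> x [^] k)) (carrier N) (carrier N)"
    by (rule bij_betw_trans[OF Suc bij_ract_x])
  moreover have "v \<triangleleft>\<^bsub>N\<^esub> x [^] Suc k = (v \<triangleleft>\<^bsub>N\<^esub> x [^] k) \<triangleleft>\<^bsub>N\<^esub> x" if "v \<in> carrier N" for v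
    using N.ract_mult[OF that, of "x [^] k" x] by (simp add: pow_B x_in_B)
  ultimately show ?case
    by (subst bij_betw_cong[where g="(\<lambda>v. v \<triangleleft>\<^bsub>N\<^esub> x) \<circ> (\<lambda>v. v \<triangleleft>\<^bsub>N\<^esub> x [^] k)"]) auto
qed

lemma cancel_pow:
  "v \<in> carrier N \<Longrightarrow> w \<in> carrier N \<Longrightarrow> v \<triangleleft>\<^bsub>N\<^esub> x [^] (k::nat) = w \<triangleleft>\<^bsub>N\<^esub> x [^] k \<Longrightarrow> v = w"
  using bij_ract_pow[of k] by (auto simp: bij_betw_def inj_on_def)

text \<open>The value is \<open>(v (u x^k)) x^-k\<close>. Quantifying over every admissible
  \<open>k\<close> avoids fixing a denominator; existence and uniqueness come from the bijectivity
  of the powers of \<open>x\<close>.\<close>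

definition ext_act :: "'v \<Rightarrow> 'a \<Rightarrow> 'v" where
  "ext_act v u = (THE w. w \<in> carrier N \<and>
     (\<forall>k::nat. u \<otimes> x [^] k \<in> B \<longrightarrow> w \<triangleleft>\<^bsub>N\<^esub> x [^] k = v \<triangleleft>\<^bsub>N\<^esub> (u \<otimes> x [^] k)))"

lemma act_pow_indep:
  assumes "v \<in> carrier N" "w \<in> carrier N" "u \<in> carrier R"
    and "u \<otimes> x [^] (k::nat) \<in> B" "u \<otimes> x [^] (l::nat) \<in> B"
    and eq: "w \<triangleleft>\<^bsub>N\<^esub> x [^] k = v \<triangleleft>\<^bsub>N\<^esub> (u \<otimes> x [^] k)"
  shows "w \<triangleleft>\<^bsub>N\<^esub> x [^] l = v \<triangleleft>\<^bsub>N\<^esub> (u \<otimes> x [^] l)"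
proof -
  have pw: "(v' \<triangleleft>\<^bsub>N\<^esub> x [^] i) \<triangleleft>\<^bsub>N\<^esub> x [^] j = v' \<triangleleft>\<^bsub>N\<^esub> x [^] (i + j)" if "v' \<in> carrier N" for v' and i j :: nat
    using N.ract_mult[OF that, of "x [^] i" "x [^] j"] x_carrier by (simp add: pow_B nat_pow_mult)
  have pu: "(v \<triangleleft>\<^bsub>N\<^esub> (u \<otimes> x [^] i)) \<triangleleft>\<^bsub>N\<^esub> x [^] j = v \<triangleleft>\<^bsub>N\<^esub> (u \<otimes> x [^] (i + j))"
    if "u \<otimes> x [^] i \<in> B" for i j :: nat
    using N.ract_mult[OF \<open>v \<in> carrier N\<close>, of "u \<otimes> x [^] i" "x [^] j"] x_carrier that \<open>u \<in> carrier R\<close>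
    by (simp add: pow_B nat_pow_mult m_assoc)
  show ?thesis
  proof (rule cancel_pow)
    \<comment> \<open>Both sides equal \<open>v (u x^(k + l))\<close>, so \<open>x^k\<close> can be
      cancelled.\<close>
    show "(w \<triangleleft>\<^bsub>N\<^esub> x [^] l) \<triangleleft>\<^bsub>N\<^esub> x [^] k = (v \<triangleleft>\<^bsub>N\<^esub> (u \<otimes> x [^] l)) \<triangleleft>\<^bsub>N\<^esub> x [^] k"
      using pw[OF assms(2), of l k] pw[OF assms(2), of k l] pu[OF assms(4), of l] pu[OF assms(5), of k] eq
      by (simp add: add.commute)
  qed (use assms pow_B N.ract_closed in auto)
qed

lemma ext_act_eqI:
  assumes "v \<in> carrier N" "w \<in> carrier N" "u \<in> carrier R" "u \<otimes> x [^] (k::nat) \<in> B"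
    and "w \<triangleleft>\<^bsub>N\<^esub> x [^] k = v \<triangleleft>\<^bsub>N\<^esub> (u \<otimes> x [^] k)"
  shows "ext_act v u = w"
  unfolding ext_act_def
proof (rule the_equality)
  show "w \<in> carrier N \<and> (\<forall>k::nat. u \<otimes> x [^] k \<in> B \<longrightarrow> w \<triangleleft>\<^bsub>N\<^esub> x [^] k = v \<triangleleft>\<^bsub>N\<^esub> (u \<otimes> x [^] k))"
    using act_pow_indep assms by blast
qed (use assms cancel_pow in metis)

lemma ext_act:
  assumes v: "v \<in> carrier N" and u: "u \<in> carrier R"
  shows ext_act_closed: "ext_act v u \<in> carrier N"
    and ext_act_pow: "u \<otimes> x [^] (l::nat) \<in> B \<Longrightarrow> ext_act v u \<triangleleft>\<^bsub>N\<^esub> x [^] l = v \<triangleleft>\<^bsub>N\<^esub> (u \<otimes> x [^] l)"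
proof -
  obtain k :: nat where k: "u \<otimes> x [^] k \<in> B"
    using denominator u by blast
  then have "v \<triangleleft>\<^bsub>N\<^esub> (u \<otimes> x [^] k) \<in> (\<lambda>v. v \<triangleleft>\<^bsub>N\<^esub> x [^] k) ` carrier N"
    using bij_ract_pow[of k] N.ract_closed[OF v] by (simp add: bij_betw_def)
  then obtain w where w: "w \<in> carrier N" "w \<triangleleft>\<^bsub>N\<^esub> x [^] k = v \<triangleleft>\<^bsub>N\<^esub> (u \<otimes> x [^] k)"
    by fastforce
  have "ext_act v u = w"
    by (rule ext_act_eqI[OF v w(1) u k w(2)])
  with w(1) show "ext_act v u \<in> carrier N"
    by simp
  show "ext_act v u \<triangleleft>\<^bsub>N\<^esub> x [^] l = v \<triangleleft>\<^bsub>N\<^esub> (u \<otimes> x [^] l)" if "u \<otimes> x [^] (l::nat) \<in> B"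
    unfolding \<open>ext_act v u = w\<close> by (rule act_pow_indep[OF v w(1) u k that w(2)])
qed

lemma ext_act_B: "v \<in> carrier N \<Longrightarrow> b \<in> B \<Longrightarrow> ext_act v b = v \<triangleleft>\<^bsub>N\<^esub> b"
  using N.ract_one[of "v \<triangleleft>\<^bsub>N\<^esub> b"] N.ract_closed[of v b]
  by (intro ext_act_eqI[where k=0]) (auto simp: B_carrier)

lemma ext_act_mult:
  assumes v: "v \<in> carrier N" and u: "u \<in> carrier R" "u' \<in> carrier R"
  shows "ext_act v (u \<otimes> u') = ext_act (ext_act v u) u'"
proof -
  obtain k l :: nat where k: "u \<otimes> x [^] k \<in> B" and l: "u' \<otimes> x [^] l \<in> B"
    using denominator u by blast
  \<comment> \<open>To multiply fractions, the denominator \<open>x^k\<close> of \<open>u\<close>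
    must stand directly behind \<open>u\<close>; normality moves it across \<open>u' x^l\<close>,
    and then \<open>u u' x^(l + k) = (u x^k) b\<close>.\<close>
  obtain b where b: "b \<in> B" "(u' \<otimes> x [^] l) \<otimes> x [^] k = x [^] k \<otimes> b"
    using normal_right_pow[OF l] by blast
  let ?w = "ext_act v u"
  have w: "?w \<in> carrier N"
    using ext_act_closed v u by blast
  have cr: "b \<in> carrier R"
    using b B_carrier by blast
  have eq: "(u \<otimes> u') \<otimes> x [^] (l + k) = (u \<otimes> x [^] k) \<otimes> b"
  proof -
    have "(u \<otimes> u') \<otimes> x [^] (l + k) = u \<otimes> ((u' \<otimes> x [^] l) \<otimes> x [^] k)"
      using u x_carrier by (simp add: nat_pow_mult[symmetric] m_assoc)
    then show ?thesis
      using u x_carrier cr by (simp add: b m_assoc)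
  qed
  have w': "ext_act ?w u' \<in> carrier N"
    using ext_act_closed w u by blast
  have "ext_act ?w u' \<triangleleft>\<^bsub>N\<^esub> x [^] (l + k) = (ext_act ?w u' \<triangleleft>\<^bsub>N\<^esub> x [^] l) \<triangleleft>\<^bsub>N\<^esub> x [^] k"
    using N.ract_mult[OF w', of "x [^] l" "x [^] k"] x_carrier by (simp add: pow_B nat_pow_mult)
  also have "\<dots> = (?w \<triangleleft>\<^bsub>N\<^esub> (u' \<otimes> x [^] l)) \<triangleleft>\<^bsub>N\<^esub> x [^] k"
    using ext_act_pow[OF w u(2) l] by simp
  also have "\<dots> = (?w \<triangleleft>\<^bsub>N\<^esub> x [^] k) \<triangleleft>\<^bsub>N\<^esub> b"
    using N.ract_mult[OF w, of "u' \<otimes> x [^] l" "x [^] k"] N.ract_mult[OF w, of "x [^] k" b] b l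
    by (simp add: pow_B)
  also have "\<dots> = v \<triangleleft>\<^bsub>N\<^esub> ((u \<otimes> u') \<otimes> x [^] (l + k))"
    using ext_act_pow[OF v u(1) k] N.ract_mult[OF v, of "u \<otimes> x [^] k" b] b k by (simp add: eq)
  finally show ?thesis
    using v u w' k b by (intro ext_act_eqI[where k="l + k"]) (auto simp: eq B_closed)
qed

lemma ext_act_add_left:
  assumes "v \<in> carrier N" "w \<in> carrier N" "u \<in> carrier R"
  shows "ext_act (v \<oplus>\<^bsub>N\<^esub> w) u = ext_act v u \<oplus>\<^bsub>N\<^esub> ext_act w u"
proof -
  obtain k :: nat where k: "u \<otimes> x [^] k \<in> B"
    using denominator assms by blast
  have "(ext_act v u \<oplus>\<^bsub>N\<^esub> ext_act w u) \<triangleleft>\<^bsub>N\<^esub> x [^] k = (v \<oplus>\<^bsub>N\<^esub> w) \<triangleleft>\<^bsub>N\<^esub> (u \<otimes> x [^] k)"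
    using assms k by (simp add: N.ract_add_left ext_act_closed pow_B ext_act_pow)
  then show ?thesis
    using assms k by (intro ext_act_eqI[where k=k]) (auto simp: ext_act_closed)
qed

lemma ext_act_add_right:
  assumes "v \<in> carrier N" "u \<in> carrier R" "u' \<in> carrier R"
  shows "ext_act v (u \<oplus> u') = ext_act v u \<oplus>\<^bsub>N\<^esub> ext_act v u'"
proof -
  obtain k :: nat where k: "u \<otimes> x [^] k \<in> B" "u' \<otimes> x [^] k \<in> B"
    using denominator2 assms by blast
  have eq: "(u \<oplus> u') \<otimes> x [^] k = u \<otimes> x [^] k \<oplus> u' \<otimes> x [^] k"
    using assms x_carrier by (simp add: l_distr)
  have "(ext_act v u \<oplus>\<^bsub>N\<^esub> ext_act v u') \<triangleleft>\<^bsub>N\<^esub> x [^] k = v \<triangleleft>\<^bsub>N\<^esub> ((u \<oplus> u') \<otimes> x [^] k)"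
    using assms k N.ract_add_right[of v "u \<otimes> x [^] k" "u' \<otimes> x [^] k"]
    by (simp add: N.ract_add_left ext_act_closed pow_B ext_act_pow eq)
  then show ?thesis
    using assms k by (intro ext_act_eqI[where k=k]) (auto simp: ext_act_closed eq B_closed)
qed

text \<open>Carrier and addition stay those of \<open>N\<close>, so that the identity map is the
  isomorphism over the subring.\<close>

definition ext where "ext = N\<lparr>ract := ext_act\<rparr>"

lemma ext_simps [simp]: "carrier ext = carrier N" "\<zero>\<^bsub>ext\<^esub> = \<zero>\<^bsub>N\<^esub>" "add ext = add N" "ract ext = ext_act"
  by (simp_all add: ext_def)

lemma add_monoid_ext: "add_monoid ext = add_monoid N"
  by simp

lemma right_module_ext: "right_module R ext"
proof (intro right_module.intro right_module_axioms.intro)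
  show "ring R" ..
  show "abelian_group ext"
  proof (intro abelian_group.intro abelian_monoid.intro abelian_group_axioms.intro)
    show "comm_monoid (add_monoid ext)" "comm_group (add_monoid ext)"
      unfolding add_monoid_ext by (rule N.M.a_comm_monoid, rule N.M.a_comm_group)
  qed
next
  fix v assume "v \<in> carrier ext"
  then show "v \<triangleleft>\<^bsub>ext\<^esub> \<one> = v"
    using ext_act_B[of v \<one>] N.ract_one[of v] B_closed by simp
qed (simp_all add: ext_act_closed ext_act_add_left ext_act_add_right ext_act_mult)

text \<open>On \<open>B\<close> the extended action is the old one. Submodules over the whole ring
  are therefore submodules of \<open>N\<close>, and powers of \<open>x\<close> act as
  before.\<close>

lemma ext_simple_tf: "ext \<in> simple_tf R x"
proof -
  have "H = {\<zero>\<^bsub>N\<^esub>} \<or> H = carrier N" if H: "right_submodule R ext H" for H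
  proof (rule simple_tfD(4)[OF N])
    have "additive_subgroup H N"
      using H unfolding right_submodule_def additive_subgroup_def add_monoid_ext by blast
    moreover have "v \<triangleleft>\<^bsub>N\<^esub> b \<in> H" if "v \<in> H" "b \<in> B" for v b
    proof -
      have "ext_act v b \<in> H"
        using H that B_carrier by (simp add: right_submodule_def)
      moreover have "v \<in> carrier N"
        using additive_subgroup.a_subset[OF \<open>additive_subgroup H N\<close>] that(1) by blast
      ultimately show ?thesis
        using ext_act_B that(2) by simp
    qed
    ultimately show "right_submodule RB N H"
      by (simp add: right_submodule_def)
  qed
  moreover have "torsionfree_wrt R x ext"
    using torsionfree pow_B by (simp add: torsionfree_wrt_def ext_act_B)
  ultimately show ?thesis
    using right_module_ext simple_tfD(2)[OF N] by (simp add: simple_tf_def simple_right_module_def)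
qed

lemma ext_isomorphic: "right_module_isomorphic RB ext N"
  unfolding right_module_isomorphic_def
  by (rule exI[of _ "\<lambda>v. v"]) (auto simp: bij_betw_def ext_act_B)

end

section \<open>Restriction to the subring and the bijection of isomorphism classes\<close>

context ore_pair
begin

text \<open>For \<open>f\<close> linear over \<open>B\<close>,
  \<open>f (v u) x^k = f (v (u x^k)) = (f v u) x^k\<close>, and \<open>x^k\<close> cancels in the
  torsionfree target.\<close>

lemma isomorphic_extend:
  assumes M: "right_module R M" and M': "M' \<in> simple_tf R x"
    and iso: "right_module_isomorphic RB M M'"
  shows "right_module_isomorphic R M M'"
proof -
  interpret M: right_module R M by fact
  interpret M': right_module R M' by (rule simple_tfD(1)[OF M'])
  obtain f where f: "bij_betw f (carrier M) (carrier M')"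
     "\<forall>v\<in>carrier M. \<forall>w\<in>carrier M. f (v \<oplus>\<^bsub>M\<^esub> w) = f v \<oplus>\<^bsub>M'\<^esub> f w"
     "\<forall>v\<in>carrier M. \<forall>b\<in>B. f (v \<triangleleft>\<^bsub>M\<^esub> b) = f v \<triangleleft>\<^bsub>M'\<^esub> b"
    using iso unfolding right_module_isomorphic_def by auto
  have "f (v \<triangleleft>\<^bsub>M\<^esub> u) = f v \<triangleleft>\<^bsub>M'\<^esub> u" if v: "v \<in> carrier M" and u: "u \<in> carrier R" for v u
  proof -
    obtain k :: nat where k: "u \<otimes> x [^] k \<in> B"
      using denominator u by blast
    have vu: "v \<triangleleft>\<^bsub>M\<^esub> u \<in> carrier M" "f v \<in> carrier M'"
      using M.ract_closed v u f(1) by (auto simp: bij_betwE)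
    have "f (v \<triangleleft>\<^bsub>M\<^esub> u) \<triangleleft>\<^bsub>M'\<^esub> x [^] k = f ((v \<triangleleft>\<^bsub>M\<^esub> u) \<triangleleft>\<^bsub>M\<^esub> x [^] k)"
      using f(3) vu pow_B by simp
    also have "\<dots> = f v \<triangleleft>\<^bsub>M'\<^esub> (u \<otimes> x [^] k)"
      using f(3) v k u pow_carrier by (simp add: M.ract_mult[symmetric])
    also have "\<dots> = (f v \<triangleleft>\<^bsub>M'\<^esub> u) \<triangleleft>\<^bsub>M'\<^esub> x [^] k"
      using vu u pow_carrier by (simp add: M'.ract_mult)
    finally show ?thesis
      using M'.ract_cancel[OF simple_tfD(3)[OF M'] x_carrier] vu u M'.ract_closed f(1)
      by (meson bij_betwE)
  qed
  then show ?thesis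
    unfolding right_module_isomorphic_def using f by blast
qed

text \<open>The element \<open>y\<close> inverts \<open>x^k\<close> on \<open>M\<close> from inside
  \<open>B\<close>. Hence \<open>v u = v (u x^k) y\<close> stays in any submodule over
  \<open>B\<close> that contains \<open>v\<close>.\<close>

lemma restrict_simple_tf:
  assumes M: "M \<in> simple_tf R x"
    and unit: "\<And>k::nat. \<exists>y\<in>B. \<forall>v\<in>carrier M. v \<triangleleft>\<^bsub>M\<^esub> (x [^] k \<otimes> y) = v"
  shows "M \<in> simple_tf RB x"
proof -
  interpret M: right_module R M by (rule simple_tfD(1)[OF M])
  interpret MB: right_module RB M by (rule M.restrict_subring[OF subring_B])
  have "H = {\<zero>\<^bsub>M\<^esub>} \<or> H = carrier M" if H: "right_submodule RB M H" for H
  proof (rule simple_tfD(4)[OF M])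
    have sub: "H \<subseteq> carrier M"
      using H unfolding right_submodule_def by (meson additive_subgroup.a_subset)
    have "v \<triangleleft>\<^bsub>M\<^esub> u \<in> H" if v: "v \<in> H" and u: "u \<in> carrier R" for v u
    proof -
      obtain k :: nat where k: "u \<otimes> x [^] k \<in> B"
        using denominator u by blast
      obtain y where y: "y \<in> B" "\<forall>v\<in>carrier M. v \<triangleleft>\<^bsub>M\<^esub> (x [^] k \<otimes> y) = v"
        using unit by blast
      have vM: "v \<in> carrier M"
        using v sub by blast
      have "v \<triangleleft>\<^bsub>M\<^esub> u = (v \<triangleleft>\<^bsub>M\<^esub> u) \<triangleleft>\<^bsub>M\<^esub> (x [^] k \<otimes> y)"
        using y vM u M.ract_closed by simp
      also have "\<dots> = v \<triangleleft>\<^bsub>M\<^esub> ((u \<otimes> x [^] k) \<otimes> y)"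
        using y B_carrier vM u pow_carrier by (simp add: M.ract_mult[symmetric] m_assoc)
      also have "\<dots> \<in> H"
        using H v k y by (simp add: right_submodule_def B_closed)
      finally show ?thesis .
    qed
    then show "right_submodule R M H"
      using H by (simp add: right_submodule_def)
  qed
  then show ?thesis
    using MB.right_module_axioms simple_tfD(2,3)[OF M]
    by (simp add: simple_tf_def simple_right_module_def torsionfree_B)
qed

text \<open>Extension of the action works for every such pair of rings. Simplicity of the
  restriction is the delicate direction, and the hypothesis isolates what it takes; for
  \<open>U\<close> the roots of unity will supply it.\<close>

theorem iso_classes_bij:
  assumes "\<And>(M :: ('a, 'v) right_module) (k::nat). M \<in> simple_tf R x \<Longrightarrow>
      \<exists>y\<in>B. \<forall>v\<in>carrier M. v \<triangleleft>\<^bsub>M\<^esub> (x [^] k \<otimes> y) = v"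
  shows "\<exists>\<Phi>. bij_betw \<Phi>
      ((simple_tf R x :: ('a, 'v) right_module set) // iso_rel R x)
      ((simple_tf RB x :: ('a, 'v) right_module set) // iso_rel RB x)
    \<and> (\<forall>M \<in> simple_tf R x. \<Phi> (iso_rel R x `` {M}) = iso_rel RB x `` {M})"
proof (rule bij_betw_quotient_of_subset[OF equiv_iso_rel equiv_iso_rel])
  show sub: "simple_tf R x \<subseteq> (simple_tf RB x :: ('a, 'v) right_module set)"
    using restrict_simple_tf assms by blast
  show "(M, M') \<in> iso_rel R x \<longleftrightarrow> (M, M') \<in> iso_rel RB x"
    if M: "M \<in> simple_tf R x" "M' \<in> simple_tf R x" for M M' :: "('a, 'v) right_module"
  proof -
    have "right_module_isomorphic RB M M'" if iso: "right_module_isomorphic R M M'"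
    proof -
      obtain f where "bij_betw f (carrier M) (carrier M')"
        "\<forall>v\<in>carrier M. \<forall>w\<in>carrier M. f (v \<oplus>\<^bsub>M\<^esub> w) = f v \<oplus>\<^bsub>M'\<^esub> f w"
        "\<forall>v\<in>carrier M. \<forall>a\<in>carrier R. f (v \<triangleleft>\<^bsub>M\<^esub> a) = f v \<triangleleft>\<^bsub>M'\<^esub> a"
        using iso unfolding right_module_isomorphic_def by blast
      then show ?thesis
        unfolding right_module_isomorphic_def by (intro exI[of _ f]) (simp add: B_carrier)
    qed
    then show ?thesis
      using M sub isomorphic_extend[OF simple_tfD(1)[OF M(1)] M(2)] by (auto simp: iso_rel_def)
  qed
  show "\<exists>M\<in>simple_tf R x. (M, N) \<in> iso_rel RB x" if "N \<in> simple_tf RB x"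
    for N :: "('a, 'v) right_module"
  proof -
    interpret simple_tf_B R B x N
      by unfold_locales fact
    show ?thesis
      using ext_simple_tf ext_isomorphic subsetD[OF sub ext_simple_tf] that
      by (intro bexI[of _ ext]) (simp_all add: iso_rel_def)
  qed
qed

end


section \<open>The free algebra\<close>

lemma scal_0 [simp]: "scal 0 = 0" and scal_1 [simp]: "scal 1 = 1"
  and scal_add: "scal (a + b) = scal a + scal b"
  and scal_mult: "scal (a * b) = scal a * scal b"
  by (simp_all add: scal_def single_add mult_single)

lemma scal_minus: "scal (- a) = - scal a"
  by (simp add: scal_def single_uminus)

lemma scal_diff: "scal (a - b) = scal a - scal b"
  by (simp add: scal_def single_diff)

lemma update_eq_add:
  "a \<notin> Poly_Mapping.keys f \<Longrightarrow> Poly_Mapping.update a b f = f + Poly_Mapping.single a b"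
  by (intro poly_mapping_eqI) (auto simp: lookup_update lookup_add lookup_single when_def in_keys_iff)

lemma scal_central: "p * scal c = scal c * p"
proof (induction p rule: update_induct)
  case const
  then show ?case by simp
next
  case (update f a b)
  then show ?case
    by (simp add: scal_def distrib_left distrib_right mult_single mult.commute update_eq_add)
qed

lemma scal_left_commute: "p * (scal c * q) = scal c * (p * q)"
  by (metis mult.assoc scal_central)

lemma lookup_scal_mult: "Poly_Mapping.lookup (scal c * p) w = c * Poly_Mapping.lookup p w"
proof (induction p rule: update_induct)
  case const
  then show ?case by simp
next
  case (update f a b)
  then show ?case
    by (simp add: scal_def distrib_left lookup_add mult_single lookup_single when_def update_eq_add)
qed

text \<open>Generators are prepended because powers of \<open>e1\<close> will be attached on the
  right, and because in a right module the leftmost letter acts first.\<close>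

lemma free_alg_induct [case_names scal add e1 e2]:
  assumes scal: "\<And>c. P (scal c)" and add: "\<And>p q. P p \<Longrightarrow> P q \<Longrightarrow> P (p + q)"
    and e1: "\<And>p. P p \<Longrightarrow> P (e1 * p)" and e2: "\<And>p. P p \<Longrightarrow> P (e2 * p)"
  shows "P p"
proof (induction p rule: update_induct)
  case const
  then show ?case using scal[of 0] by simp
next
  case (update f a b)
  have "P (Poly_Mapping.single (Word ws) b)" for ws
  proof (induction ws)
    case Nil
    then show ?case
      using scal[of b] by (simp add: scal_def zero_gen_word_def)
  next
    case (Cons g ws)
    have "Poly_Mapping.single (Word (g # ws)) b =
        (case g of E1 \<Rightarrow> e1 | E2 \<Rightarrow> e2) * Poly_Mapping.single (Word ws) b"
      by (simp add: e1_def e2_def mult_single plus_gen_word_def split: gen.split)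
    then show ?case
      using e1[OF Cons] e2[OF Cons] by (cases g) simp_all
  qed
  then have "P (Poly_Mapping.single a b)"
    by (metis gen_word.exhaust)
  then show ?case
    using update add by (simp add: update_eq_add)
qed

text \<open>There are countably many words, hence countably many finite supports; this is the
  countable dimension used in Schur's lemma.\<close>

instance gen :: countable by countable_datatype
instance gen_word :: countable by countable_datatype

section \<open>Homogeneous linear systems with more unknowns than equations\<close>

lemma homogeneous_system:
  fixes f :: "'i \<Rightarrow> 'k \<Rightarrow> 'f::field"
  assumes "finite K" "finite S" "card K < card S"
  shows "\<exists>a. (\<exists>i\<in>S. a i \<noteq> 0) \<and> (\<forall>k\<in>K. (\<Sum>i\<in>S. a i * f i k) = 0)"
  using assms
proof (induction K arbitrary: S f rule: finite_induct)
  case empty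
  then have "S \<noteq> {}" by auto
  then show ?case by (intro exI[of _ "\<lambda>_. 1"]) auto
next
  case (insert k K)
  show ?case
  proof (cases "\<forall>i\<in>S. f i k = 0")
    case True
    then show ?thesis
      using insert.IH[of S f] insert by auto
  next
    case False
    then obtain j where j: "j \<in> S" "f j k \<noteq> 0" by blast
    define S' where "S' = S - {j}"
    \<comment> \<open>Gaussian elimination: equation \<open>k\<close> is solved for the unknown
      \<open>a j\<close>, and \<open>g\<close> holds the coefficients after substitution. The solved
      value is \<open>t\<close> below.\<close>
    define g where "g i l = f i l - f i k / f j k * f j l" for i l
    have S': "S = insert j S'" "j \<notin> S'" "finite S'"
      using j insert.prems by (auto simp: S'_def)
    have "card K < card S'"
      using insert S' by simp
    then obtain a where a: "\<exists>i\<in>S'. a i \<noteq> 0" "\<forall>l\<in>K. (\<Sum>i\<in>S'. a i * g i l) = 0"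
      using insert.IH S'(3) by blast
    define t where "t = - (\<Sum>i\<in>S'. a i * f i k) / f j k"
    have sum: "(\<Sum>i\<in>S. (a(j := t)) i * f i l) = t * f j l + (\<Sum>i\<in>S'. a i * f i l)" for l
      using S' by (auto intro!: arg_cong2[where f="(+)"] sum.cong)
    have "(\<Sum>i\<in>S. (a(j := t)) i * f i k) = 0"
      unfolding sum using j by (simp add: t_def)
    moreover have "(\<Sum>i\<in>S. (a(j := t)) i * f i l) = 0" if "l \<in> K" for l
    proof -
      have "(\<Sum>i\<in>S'. a i * g i l) = t * f j l + (\<Sum>i\<in>S'. a i * f i l)"
        by (simp add: g_def t_def algebra_simps sum_subtractf sum_distrib_left sum_divide_distrib)
      then show ?thesis
        using a that unfolding sum by simp
    qed
    moreover have "\<exists>i\<in>S. (a(j := t)) i \<noteq> 0"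
      using a(1) S' by (metis fun_upd_other insertCI)
    ultimately show ?thesis
      by (intro exI[of _ "a(j := t)"]) blast
  qed
qed

section \<open>Complex polynomials evaluated at an element of the free algebra\<close>

definition poly_at :: "free_alg \<Rightarrow> complex poly \<Rightarrow> free_alg" where
  "poly_at z P = fold_coeffs (\<lambda>c y. scal c + y * z) P 0"

lemma poly_at_0 [simp]: "poly_at z 0 = 0"
  by (simp add: poly_at_def)

lemma poly_at_pCons [simp]: "poly_at z (pCons c P) = scal c + poly_at z P * z"
  by (cases "c = 0 \<and> P = 0") (auto simp: poly_at_def)

lemma poly_at_add: "poly_at z (P + Q) = poly_at z P + poly_at z Q"
  by (induction P Q rule: poly_induct2) (simp_all add: scal_add algebra_simps)

lemma poly_at_smult: "poly_at z (smult c P) = scal c * poly_at z P"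
  by (induction P) (simp_all add: scal_mult distrib_left mult.assoc)

lemma poly_at_sum: "poly_at z (\<Sum>i\<in>S. P i) = (\<Sum>i\<in>S. poly_at z (P i))"
  by (induction S rule: infinite_finite_induct) (simp_all add: poly_at_add)

lemma poly_at_commute: "z * poly_at z P = poly_at z P * z"
  by (induction P) (simp_all add: distrib_left distrib_right scal_central mult.assoc[symmetric])

text \<open>The linear factor is split off on the left, so that in a right module it acts
  first.\<close>

lemma poly_at_linear_mult: "poly_at z ([:- c, 1:] * P) = (z - scal c) * poly_at z P"
proof -
  have "[:- c, 1:] * P = smult (- c) P + pCons 0 P"
    by simp
  then show ?thesis
    by (simp only: poly_at_add poly_at_smult poly_at_pCons)
      (simp add: poly_at_commute scal_minus left_diff_distrib)
qed


section \<open>Relations in the algebra\<close>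

lemma ring_free_ring: "ring free_ring"
proof (rule ringI)
  show "abelian_group free_ring"
  proof (rule abelian_groupI)
    show "\<And>p. p \<in> carrier free_ring \<Longrightarrow> \<exists>q\<in>carrier free_ring. q \<oplus>\<^bsub>free_ring\<^esub> p = \<zero>\<^bsub>free_ring\<^esub>"
      by (rule bexI[of _ "- p" for p]) (auto simp: free_ring_def)
  qed (auto simp: free_ring_def algebra_simps)
  show "monoid free_ring"
    by (rule monoidI) (auto simp: free_ring_def algebra_simps)
qed (auto simp: free_ring_def algebra_simps)

lemma free_ring_simps [simp]:
  "carrier free_ring = UNIV" "x \<otimes>\<^bsub>free_ring\<^esub> y = x * y" "x \<oplus>\<^bsub>free_ring\<^esub> y = x + y"
  "\<one>\<^bsub>free_ring\<^esub> = 1" "\<zero>\<^bsub>free_ring\<^esub> = 0"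
  by (simp_all add: free_ring_def)

lemma ideal_rel_ideal: "ideal (rel_ideal r s) free_ring"
  unfolding rel_ideal_def by (rule ring.genideal_ideal[OF ring_free_ring]) simp

lemma ring_Uplus: "ring (Uplus r s)"
  unfolding Uplus_def by (rule ideal.quotient_is_ring[OF ideal_rel_ideal])

lemma proj_hom: "ring_hom_ring free_ring (Uplus r s) (proj r s)"
  unfolding Uplus_def proj_def [abs_def] by (rule ideal.rcos_ring_hom_ring[OF ideal_rel_ideal])

lemma carrier_Uplus: "carrier (Uplus r s) = range (proj r s)"
  by (auto simp: Uplus_def FactRing_def A_RCOSETS_def' proj_def)

lemma proj_closed [simp]: "proj r s p \<in> carrier (Uplus r s)"
  by (simp add: carrier_Uplus)

lemma proj_ring:
  "proj r s (p * q) = proj r s p \<otimes>\<^bsub>Uplus r s\<^esub> proj r s q"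
  "proj r s (p + q) = proj r s p \<oplus>\<^bsub>Uplus r s\<^esub> proj r s q"
  "proj r s 1 = \<one>\<^bsub>Uplus r s\<^esub>"
  "proj r s 0 = \<zero>\<^bsub>Uplus r s\<^esub>"
proof -
  interpret ring_hom_ring free_ring "Uplus r s" "proj r s" by (rule proj_hom)
  show "proj r s (p * q) = proj r s p \<otimes>\<^bsub>Uplus r s\<^esub> proj r s q"
    "proj r s (p + q) = proj r s p \<oplus>\<^bsub>Uplus r s\<^esub> proj r s q"
    "proj r s 1 = \<one>\<^bsub>Uplus r s\<^esub>" "proj r s 0 = \<zero>\<^bsub>Uplus r s\<^esub>"
    using hom_mult[of p q] hom_add[of p q] hom_one hom_zero by simp_all
qed

lemma proj_minus: "proj r s (- p) = \<ominus>\<^bsub>Uplus r s\<^esub> proj r s p"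
proof -
  interpret ring "Uplus r s" by (rule ring_Uplus)
  have "proj r s (- p) \<oplus>\<^bsub>Uplus r s\<^esub> proj r s p = \<zero>\<^bsub>Uplus r s\<^esub>"
    by (simp add: proj_ring[symmetric])
  then show ?thesis
    by (rule minus_equality[symmetric]) simp_all
qed

lemma proj_pow: "proj r s (p ^ n) = proj r s p [^]\<^bsub>Uplus r s\<^esub> n"
proof -
  interpret ring "Uplus r s" by (rule ring_Uplus)
  show ?thesis
    by (induction n) (simp_all add: proj_ring power_Suc2 del: power_Suc)
qed

text \<open>Relations in \<open>U\<close> are checked as exact identities in the free algebra, with
  an explicit error term \<open>t\<close> from the ideal.\<close>

lemma proj_eqI:
  assumes "p - q = t" "proj r s t = \<zero>\<^bsub>Uplus r s\<^esub>"
  shows "proj r s p = proj r s q"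
proof -
  interpret ring "Uplus r s" by (rule ring_Uplus)
  have "p = t + q"
    unfolding assms(1)[symmetric] by simp
  then show ?thesis
    using assms(2) by (simp add: proj_ring)
qed

lemma proj_serre1: "proj r s (serre1 r s) = \<zero>\<^bsub>Uplus r s\<^esub>"
proof -
  interpret ideal "rel_ideal r s" free_ring
    by (rule ideal_rel_ideal)
  have "serre1 r s \<in> rel_ideal r s"
    unfolding rel_ideal_def using ring.genideal_self[OF ring_free_ring, of "{serre1 r s, serre2 r s}"]
    by auto
  then show ?thesis
    by (simp add: proj_def a_rcos_const Uplus_def FactRing_def)
qed

lemma proj_serre1_mult: "proj r s (p * serre1 r s * q) = \<zero>\<^bsub>Uplus r s\<^esub>"
proof -
  interpret ring "Uplus r s" by (rule ring_Uplus)
  show ?thesis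
    by (simp add: proj_ring proj_serre1)
qed

section \<open>Commutation of \<open>X\<^sub>1\<close> with the generators of the subalgebra\<close>

lemmas scal_simps = scal_central[of e1] scal_left_commute[of e1]
  scal_central[of e2] scal_left_commute[of e2]
  scal_central[of "x2 r" for r] scal_left_commute[of "x2 r" for r]
  scal_central[of "scal a" for a] scal_left_commute[of "scal a" for a]

text \<open>The relation between \<open>X\<^sub>1\<close> and \<open>X\<^sub>2\<close> is the first
  Serre relation itself, regrouped.\<close>

lemma e1_x2: "e1 * x2 r - scal (s^2) * x2 r * e1 = serre1 r s"
  by (simp add: x2_def serre1_def power2_eq_square[of e1] scal_mult scal_add algebra_simps scal_simps)

lemma proj_e1_x2: "proj r s (e1 * x2 r) = proj r s (scal (s^2) * (x2 r * e1))"
  using proj_eqI[OF e1_x2 proj_serre1] by (simp add: mult.assoc)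

text \<open>Moving \<open>e1\<close> to the right through both terms of \<open>x3\<close> produces
  \<open>x2 * x2\<close> twice with opposite signs. What remains beyond the right-hand side is
  \<open>r^2 e2 D - s^-2 D e2\<close>, where \<open>D\<close> is the first Serre element.\<close>

lemma proj_e1_x3:
  assumes "s \<noteq> 0"
  shows "proj r s (e1 * x3 r s) = proj r s (scal (r^2 * s^2) * (x3 r s * e1))"
proof -
  let ?D = "serre1 r s"
  have e12: "e1 * e2 = x2 r + scal (r^2) * (e2 * e1)"
    by (simp add: x2_def mult.assoc)
  \<comment> \<open>The primed rules are the same rewrites inside a right-associated
    product.\<close>
  then have e12': "e1 * (e2 * q) = x2 r * q + scal (r^2) * (e2 * (e1 * q))" for q
    by (metis distrib_right mult.assoc)
  have e1x2: "e1 * x2 r = scal (s^2) * (x2 r * e1) + ?D"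
    using e1_x2[of r s] by (simp add: algebra_simps)
  then have e1x2': "e1 * (x2 r * q) = scal (s^2) * (x2 r * (e1 * q)) + ?D * q" for q
    by (metis distrib_right mult.assoc)
  have inv: "scal (s^2) * (scal (inverse (s^2)) * q) = q" for q
    using assms by (simp add: mult.assoc[symmetric] scal_mult[symmetric])
  have inv': "scal (inverse (s^2)) * (scal (s^2) * q) = q" for q
    using assms by (simp add: mult.assoc[symmetric] scal_mult[symmetric])
  have eq: "e1 * x3 r s - scal (r^2 * s^2) * (x3 r s * e1)
      = (scal (r^2) * e2) * ?D * 1 + (- scal (inverse (s^2))) * ?D * e2"
    by (simp add: x3_def scal_mult algebra_simps scal_simps e12 e12' e1x2 e1x2' inv inv')
  have "proj r s ((scal (r^2) * e2) * ?D * 1 + (- scal (inverse (s^2))) * ?D * e2) = \<zero>\<^bsub>Uplus r s\<^esub>"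
    unfolding proj_ring(2) proj_serre1_mult
    by (simp add: ring_Uplus ring.ring_simprules)
  with eq show ?thesis
    by (rule proj_eqI)
qed

text \<open>Expanded, this is \<open>e1 * e2 - s^2 e2 * e1\<close>, that is \<open>x2\<close> with
  \<open>s\<close> in place of \<open>r\<close>; it represents the generator
  \<open>Wtilde\<close>.\<close>

definition wt :: "complex \<Rightarrow> complex \<Rightarrow> free_alg" where
  "wt r s = x2 r + scal (r^2 - s^2) * e2 * e1"

text \<open>As \<open>serre1\<close> is symmetric in \<open>r\<close> and \<open>s\<close>, this is
  \<open>e1_x2\<close> with the two parameters exchanged.\<close>

lemma e1_wt: "e1 * wt r s - scal (r^2) * (wt r s * e1) = serre1 r s"
  unfolding e1_x2[of r s, symmetric]
  by (simp add: wt_def x2_def scal_mult scal_diff algebra_simps scal_simps)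

lemma proj_e1_wt: "proj r s (e1 * wt r s) = proj r s (scal (r^2) * (wt r s * e1))"
  by (rule proj_eqI[OF e1_wt proj_serre1])

text \<open>Dividing by \<open>r^2 - s^2\<close> is what brings \<open>X\<^sub>4 X\<^sub>1\<close>
  into the subalgebra.\<close>

lemma e2_e1: "r^2 \<noteq> s^2 \<Longrightarrow> e2 * e1 = scal (1 / (r^2 - s^2)) * (wt r s - x2 r)"
  by (simp add: wt_def mult.assoc[symmetric] scal_mult[symmetric])


section \<open>Schur's lemma in countable dimension\<close>

locale Uplus_module = right_module "Uplus r s" M
  for r s and M :: "(free_alg set, 'v) right_module"
begin

text \<open>Acting through representatives keeps computations in the free algebra, away from
  cosets.\<close>

abbreviation act :: "'v \<Rightarrow> free_alg \<Rightarrow> 'v" where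
  "act v p \<equiv> v \<triangleleft>\<^bsub>M\<^esub> proj r s p"

lemma act_closed [simp]: "v \<in> carrier M \<Longrightarrow> act v p \<in> carrier M"
  by (simp add: ract_closed)

lemma act_add: "v \<in> carrier M \<Longrightarrow> act v (p + q) = act v p \<oplus>\<^bsub>M\<^esub> act v q"
  by (simp add: proj_ring ract_add_right)

lemma act_mult: "v \<in> carrier M \<Longrightarrow> act v (p * q) = act (act v p) q"
  by (simp add: proj_ring ract_mult)

lemma act_1: "v \<in> carrier M \<Longrightarrow> act v 1 = v"
  by (simp add: proj_ring ract_one)

lemma act_0: "v \<in> carrier M \<Longrightarrow> act v 0 = \<zero>\<^bsub>M\<^esub>"
  by (simp add: proj_ring ract_zero_right)

lemma act_zero: "act \<zero>\<^bsub>M\<^esub> p = \<zero>\<^bsub>M\<^esub>"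
  by (simp add: ract_zero_left)

lemma act_minus: "v \<in> carrier M \<Longrightarrow> act v (- p) = \<ominus>\<^bsub>M\<^esub> act v p"
  by (simp add: proj_minus ract_minus_right)

lemma act_diff_eq_zero: "v \<in> carrier M \<Longrightarrow> act v (p - q) = \<zero>\<^bsub>M\<^esub> \<longleftrightarrow> act v p = act v q"
proof
  assume v: "v \<in> carrier M" and "act v (p - q) = \<zero>\<^bsub>M\<^esub>"
  then show "act v p = act v q"
    using act_add[OF v, of "p - q" q] by simp
next
  assume v: "v \<in> carrier M" and "act v p = act v q"
  then show "act v (p - q) = \<zero>\<^bsub>M\<^esub>"
    using act_add[OF v, of p "- q"] by (simp add: act_minus M.r_neg)
qed

lemma act_mult_eq_zero: "v \<in> carrier M \<Longrightarrow> act v p = \<zero>\<^bsub>M\<^esub> \<Longrightarrow> act v (p * q) = \<zero>\<^bsub>M\<^esub>"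
  by (simp add: act_mult act_zero)

lemma act_scal_mult_eq_zero:
  "v \<in> carrier M \<Longrightarrow> act v p = \<zero>\<^bsub>M\<^esub> \<Longrightarrow> act v (scal c * p) = \<zero>\<^bsub>M\<^esub>"
  using act_mult_eq_zero[of v p "scal c"] by (simp add: scal_central)

lemma act_sum_eq_zero:
  assumes "v \<in> carrier M" "\<And>i. i \<in> S \<Longrightarrow> act v (p i) = \<zero>\<^bsub>M\<^esub>"
  shows "act v (\<Sum>i\<in>S. p i) = \<zero>\<^bsub>M\<^esub>"
  using assms(2)
  by (induction S rule: infinite_finite_induct) (simp_all add: act_0 act_add assms(1))

text \<open>Over the complex numbers \<open>P\<close> splits into linear factors, each of which acts
  injectively by assumption.\<close>

lemma poly_at_injective:
  assumes "\<And>c w. w \<in> carrier M \<Longrightarrow> act w (z - scal c) = \<zero>\<^bsub>M\<^esub> \<Longrightarrow> w = \<zero>\<^bsub>M\<^esub>"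
    and "P \<noteq> 0" "v \<in> carrier M" "act v (poly_at z P) = \<zero>\<^bsub>M\<^esub>"
  shows "v = \<zero>\<^bsub>M\<^esub>"
  using assms(2-4)
proof (induction "degree P" arbitrary: P v)
  case 0
  then obtain a where a: "P = [:a:]"
    by (metis degree_eq_zeroE)
  then have "act v (scal a * scal (1 / a)) = \<zero>\<^bsub>M\<^esub>"
    using 0 by (intro act_mult_eq_zero) simp_all
  then show ?case
    using a 0 by (simp add: scal_mult[symmetric] act_1)
next
  case (Suc d)
  then have "\<not> constant (poly P)"
    by (simp add: constant_degree)
  then obtain c where "poly P c = 0"
    using fundamental_theorem_of_algebra by blast
  then obtain Q where Q: "P = [:- c, 1:] * Q"
    by (auto simp: poly_eq_0_iff_dvd dvd_def)
  then have "Q \<noteq> 0" "d = degree Q"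
    using Suc by (auto simp: degree_mult_eq simp del: mult_pCons_left)
  moreover have "act (act v (z - scal c)) (poly_at z Q) = \<zero>\<^bsub>M\<^esub>"
    using Suc.prems by (simp only: Q poly_at_linear_mult act_mult)
  ultimately have "act v (z - scal c) = \<zero>\<^bsub>M\<^esub>"
    using Suc by simp
  then show ?case
    using assms(1) Suc by blast
qed

end

locale simple_Uplus_module = Uplus_module +
  assumes simple: "simple_right_module (Uplus r s) M"
begin

lemma submodule_cases: "right_submodule (Uplus r s) M N \<Longrightarrow> N = {\<zero>\<^bsub>M\<^esub>} \<or> N = carrier M"
  using simple by (simp add: simple_right_module_def)

lemma cyclic:
  assumes v: "v \<in> carrier M" "v \<noteq> \<zero>\<^bsub>M\<^esub>" and w: "w \<in> carrier M"
  shows "\<exists>p. w = act v p"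
proof -
  have "right_submodule (Uplus r s) M (range (act v))"
  proof (rule right_submoduleI)
    show "\<zero>\<^bsub>M\<^esub> \<in> range (act v)"
      using act_0[OF v(1)] by (metis rangeI)
    show "w \<oplus>\<^bsub>M\<^esub> w' \<in> range (act v)" if "w \<in> range (act v)" "w' \<in> range (act v)" for w w'
      using that by (auto simp: act_add[OF v(1), symmetric])
    show "w \<triangleleft>\<^bsub>M\<^esub> a \<in> range (act v)" if "w \<in> range (act v)" "a \<in> carrier (Uplus r s)" for w a
      using that by (auto simp: carrier_Uplus act_mult[OF v(1), symmetric])
  qed (use v in auto)
  moreover have "v \<in> range (act v)"
    using act_1[OF v(1)] by (metis rangeI)
  ultimately show ?thesis
    using submodule_cases v(2) w by blast
qed

text \<open>The image of \<open>z\<close> is a nonzero submodule, hence everything, so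
  \<open>v = w z\<close> for some \<open>w\<close>; and \<open>w = v p\<close> because
  \<open>v\<close> generates \<open>M\<close>. Thus \<open>p\<close> represents the inverse of
  \<open>z\<close> at the vector \<open>v\<close>.\<close>

lemma resolvent:
  assumes comm: "\<And>v p. v \<in> carrier M \<Longrightarrow> act v (z * p) = act v (p * z)"
    and inj: "\<And>w. w \<in> carrier M \<Longrightarrow> act w z = \<zero>\<^bsub>M\<^esub> \<Longrightarrow> w = \<zero>\<^bsub>M\<^esub>"
    and v: "v \<in> carrier M" "v \<noteq> \<zero>\<^bsub>M\<^esub>"
  shows "\<exists>p. act v (p * z) = v"
proof -
  have "right_submodule (Uplus r s) M ((\<lambda>v. act v z) ` carrier M)"
  proof (rule image_submodule)
    show "\<exists>a'\<in>carrier (Uplus r s). w \<triangleleft>\<^bsub>M\<^esub> (proj r s z \<otimes>\<^bsub>Uplus r s\<^esub> a) = w \<triangleleft>\<^bsub>M\<^esub> (a' \<otimes>\<^bsub>Uplus r s\<^esub> proj r s z)"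
      if "w \<in> carrier M" "a \<in> carrier (Uplus r s)" for w a
      using that comm by (auto simp: carrier_Uplus proj_ring[symmetric])
  qed simp
  moreover have "act v z \<noteq> \<zero>\<^bsub>M\<^esub>"
    using inj v by blast
  ultimately have "(\<lambda>v. act v z) ` carrier M = carrier M"
    using submodule_cases v(1) by blast
  then obtain w where w: "w \<in> carrier M" "v = act w z"
    using v(1) by blast
  obtain p where "w = act v p"
    using cyclic v w(1) by blast
  then have "act v (p * z) = v"
    using w(2) act_mult[OF v(1), of p z] by simp
  then show ?thesis ..
qed

text \<open>If every \<open>z - c\<close> acted injectively, the vectors \<open>v (z - c)\<^sup>-\<^sup>1 = v p\<^sub>c\<close> would exist for all \<open>c\<close>.
  Uncountably many \<open>p\<^sub>c\<close> meet only countably many finite supports, so some of them are linearly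
  dependent; clearing denominators gives a nonzero polynomial in \<open>z\<close> that annihilates \<open>v\<close>.\<close>

theorem central_acts_as_scalar:
  assumes comm: "\<And>v p. v \<in> carrier M \<Longrightarrow> act v (z * p) = act v (p * z)"
  shows "\<exists>c. \<forall>v\<in>carrier M. act v z = act v (scal c)"
proof -
  have comm': "act v ((z - scal c) * p) = act v (p * (z - scal c))" if v: "v \<in> carrier M" for v p c
  proof -
    have "act v (z * p - p * z) = \<zero>\<^bsub>M\<^esub>"
      using comm v by (simp add: act_diff_eq_zero)
    moreover have "(z - scal c) * p - p * (z - scal c) = z * p - p * z"
      by (simp add: left_diff_distrib right_diff_distrib scal_central)
    ultimately show ?thesis
      using v by (metis act_diff_eq_zero)
  qed
  have "\<exists>c w. w \<in> carrier M \<and> w \<noteq> \<zero>\<^bsub>M\<^esub> \<and> act w (z - scal c) = \<zero>\<^bsub>M\<^esub>"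
  proof (rule ccontr)
    assume "\<not> ?thesis"
    then have inj: "w = \<zero>\<^bsub>M\<^esub>" if "w \<in> carrier M" "act w (z - scal c) = \<zero>\<^bsub>M\<^esub>" for c w
      using that by blast
    obtain v where v: "v \<in> carrier M" "v \<noteq> \<zero>\<^bsub>M\<^esub>"
      using simple M.zero_closed unfolding simple_right_module_def by blast
    have "\<exists>p. act v (p * (z - scal c)) = v" for c
      using resolvent[of "z - scal c" v] comm' inj v by blast
    then obtain p where p: "act v (p c * (z - scal c)) = v" for c
      by metis
    \<comment> \<open>Real parameters already suffice: if each support occurred for only finitely
      many \<open>t\<close>, the real line would be a countable union of finite sets.\<close>
    have "\<exists>K. infinite {t::real. Poly_Mapping.keys (p (of_real t)) = K}"
    proof (rule ccontr)
      assume "\<not> ?thesis"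
      then have "countable (\<Union>K\<in>{K. finite K}. {t::real. Poly_Mapping.keys (p (of_real t)) = K})"
        by (intro countable_UN countable_Collect_finite) (auto intro: countable_finite)
      moreover have "(\<Union>K\<in>{K. finite K}. {t::real. Poly_Mapping.keys (p (of_real t)) = K}) = UNIV"
        by auto
      ultimately show False
        using uncountable_UNIV_real by simp
    qed
    then obtain K where K: "infinite {t::real. Poly_Mapping.keys (p (of_real t)) = K}"
      by blast
    \<comment> \<open>One parameter more than the size of the common support forces a linear
      dependence among the \<open>p c\<close>.\<close>
    then obtain T where T: "T \<subseteq> {t::real. Poly_Mapping.keys (p (of_real t)) = K}"
      "finite T" "card T = Suc (card K)"
      using infinite_arbitrarily_large[OF K, of "Suc (card K)"] by blast
    define S where "S = (of_real ` T :: complex set)"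
    have S: "finite S" "card S = Suc (card K)" "\<And>c. c \<in> S \<Longrightarrow> Poly_Mapping.keys (p c) = K"
      using T by (auto simp: S_def card_image inj_on_def)
    then obtain c where "c \<in> S"
      by fastforce
    then have "finite K"
      using S(3) finite_keys by blast
    then obtain a where a: "\<exists>c\<in>S. a c \<noteq> 0"
      "\<forall>k\<in>K. (\<Sum>c\<in>S. a c * Poly_Mapping.lookup (p c) k) = 0"
      using homogeneous_system[of K S "\<lambda>c. Poly_Mapping.lookup (p c)"] S by auto
    then obtain d where d: "d \<in> S" "a d \<noteq> 0"
      by blast
    have rel: "(\<Sum>c\<in>S. scal (a c) * p c) = 0"
    proof (rule poly_mapping_eqI)
      fix k
      show "Poly_Mapping.lookup (\<Sum>c\<in>S. scal (a c) * p c) k = Poly_Mapping.lookup 0 k"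
      proof (cases "k \<in> K")
        case True
        then show ?thesis
          using a(2) by (simp add: lookup_sum lookup_scal_mult)
      next
        case False
        then have "Poly_Mapping.lookup (p c) k = 0" if "c \<in> S" for c
          using S(3)[OF that] by (metis in_keys_iff)
        then show ?thesis
          by (simp add: lookup_sum lookup_scal_mult)
      qed
    qed
    define Q where "Q A = (\<Prod>c\<in>A. [:- c, 1:])" for A :: "complex set"
    \<comment> \<open>\<open>P\<close> is the numerator of the sum of the fractions
      \<open>a c / (z - c)\<close> over the common denominator \<open>Q S\<close>.\<close>
    define P where "P = (\<Sum>c\<in>S. smult (a c) (Q (S - {c})))"
    \<comment> \<open>At \<open>d\<close> every summand with \<open>c \<noteq> d\<close> contains
      the factor \<open>d - d\<close>; the remaining one is nonzero.\<close>
    have "poly P d = (\<Sum>c\<in>S. a c * (\<Prod>c'\<in>S - {c}. d - c'))"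
      by (simp add: P_def Q_def poly_sum poly_prod)
    also have "\<dots> = (\<Sum>c\<in>{d}. a c * (\<Prod>c'\<in>S - {c}. d - c'))"
      using S d by (intro sum.mono_neutral_right) auto
    also have "\<dots> \<noteq> 0"
      using S d by simp
    finally have "P \<noteq> 0"
      by auto
    moreover have "act v (poly_at z P) = \<zero>\<^bsub>M\<^esub>"
    proof -
      \<comment> \<open>Each \<open>1 - p c * (z - scal c)\<close> kills \<open>v\<close>. In the
        weighted sum the terms with \<open>p c\<close> collect to a multiple of the vanishing
        combination \<open>rel\<close>, which leaves exactly \<open>P\<close> at
        \<open>z\<close>.\<close>
      have "act v (scal (a c) * ((1 - p c * (z - scal c)) * poly_at z (Q (S - {c})))) = \<zero>\<^bsub>M\<^esub>" for c
        using p[of c] v by (intro act_scal_mult_eq_zero act_mult_eq_zero)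
          (simp_all add: act_diff_eq_zero act_1)
      then have "act v (\<Sum>c\<in>S. scal (a c) * ((1 - p c * (z - scal c)) * poly_at z (Q (S - {c})))) = \<zero>\<^bsub>M\<^esub>"
        using v by (intro act_sum_eq_zero)
      moreover have "(\<Sum>c\<in>S. scal (a c) * ((1 - p c * (z - scal c)) * poly_at z (Q (S - {c})))) = poly_at z P"
      proof -
        have "(z - scal c) * poly_at z (Q (S - {c})) = poly_at z (Q S)" if "c \<in> S" for c
          unfolding poly_at_linear_mult[symmetric] Q_def using that S(1)
          by (metis prod.remove)
        moreover have "scal (a c) * ((1 - p c * (z - scal c)) * y)
            = scal (a c) * y - scal (a c) * p c * ((z - scal c) * y)" for c y
          by (simp add: left_diff_distrib right_diff_distrib mult.assoc)
        ultimately have "(\<Sum>c\<in>S. scal (a c) * ((1 - p c * (z - scal c)) * poly_at z (Q (S - {c}))))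
            = (\<Sum>c\<in>S. scal (a c) * poly_at z (Q (S - {c})) - scal (a c) * p c * poly_at z (Q S))"
          by (intro sum.cong) simp_all
        also have "\<dots> = poly_at z P - (\<Sum>c\<in>S. scal (a c) * p c) * poly_at z (Q S)"
          by (simp add: sum_subtractf P_def poly_at_sum poly_at_smult sum_distrib_right)
        finally show ?thesis
          by (simp add: rel)
      qed
      ultimately show ?thesis
        by simp
    qed
    ultimately have "v = \<zero>\<^bsub>M\<^esub>"
      using poly_at_injective inj v(1) by blast
    then show False
      using v by simp
  qed
  then obtain c w where w: "w \<in> carrier M" "w \<noteq> \<zero>\<^bsub>M\<^esub>" "act w (z - scal c) = \<zero>\<^bsub>M\<^esub>"
    by blast
  \<comment> \<open>The eigenspace of a commuting operator is a submodule, so one eigenvector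
    settles all of \<open>M\<close>.\<close>
  have "right_submodule (Uplus r s) M {v \<in> carrier M. act v (z - scal c) = \<zero>\<^bsub>M\<^esub>}"
  proof (rule kernel_submodule)
    show "\<exists>a'\<in>carrier (Uplus r s). v \<triangleleft>\<^bsub>M\<^esub> (a \<otimes>\<^bsub>Uplus r s\<^esub> proj r s (z - scal c))
        = v \<triangleleft>\<^bsub>M\<^esub> (proj r s (z - scal c) \<otimes>\<^bsub>Uplus r s\<^esub> a')"
      if "v \<in> carrier M" "a \<in> carrier (Uplus r s)" for v a
      using that comm' by (auto simp: carrier_Uplus proj_ring[symmetric])
  qed simp
  then have "{v \<in> carrier M. act v (z - scal c) = \<zero>\<^bsub>M\<^esub>} = carrier M"
    using submodule_cases w by blast
  then show ?thesis
    by (metis (mono_tags, lifting) act_diff_eq_zero mem_Collect_eq)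
qed

end


section \<open>The subalgebra \<open>\<B>\<close>\<close>

definition B_gens :: "complex \<Rightarrow> complex \<Rightarrow> free_alg set set" where
  "B_gens r s = range (\<lambda>c. proj r s (scal c)) \<union> {X1 r s, X2 r s, X3 r s, Wtilde r s}"

lemma B_gens_carrier: "B_gens r s \<subseteq> carrier (Uplus r s)"
  by (auto simp: B_gens_def X1_def X2_def X3_def Wtilde_def)

lemma Bsub_eq: "Bsub r s = Uplus r s\<lparr>carrier := generate_ring (Uplus r s) (B_gens r s)\<rparr>"
  by (simp add: Bsub_def B_gens_def)

text \<open>The factor \<open>q\<close> is 1 for scalars and \<open>X\<^sub>1\<close>, and
  \<open>s^2\<close>, \<open>r^2 * s^2\<close>, \<open>r^2\<close> for \<open>X\<^sub>2\<close>,
  \<open>X\<^sub>3\<close>, \<open>Wtilde\<close>. Since it is nonzero, \<open>X\<^sub>1\<close> can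
  be moved across a generator in either direction.\<close>

lemma B_gens_q_commute:
  assumes "r \<noteq> 0" "s \<noteq> 0" "g \<in> B_gens r s"
  shows "\<exists>q p. q \<noteq> 0 \<and> g = proj r s p \<and> proj r s (e1 * p) = proj r s (scal q * (p * e1))"
proof -
  have "proj r s (e1 * scal c) = proj r s (scal 1 * (scal c * e1))" for c
    by (simp add: scal_central)
  moreover have "proj r s (e1 * e1) = proj r s (scal 1 * (e1 * e1))"
    by simp
  moreover have "1 \<noteq> (0::complex)" "s^2 \<noteq> 0" "r^2 * s^2 \<noteq> 0" "r^2 \<noteq> 0"
    using assms by simp_all
  ultimately show ?thesis
    using assms(3) proj_e1_x2[of r s] proj_e1_x3[OF assms(2), of r] proj_e1_wt[of r s]
    unfolding B_gens_def X1_def X2_def X3_def Wtilde_def wt_def[symmetric] by blast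
qed

abbreviation Balg :: "complex \<Rightarrow> complex \<Rightarrow> free_alg set set" where
  "Balg r s \<equiv> generate_ring (Uplus r s) (B_gens r s)"

lemma B_incl: "g \<in> B_gens r s \<Longrightarrow> g \<in> Balg r s"
  by (rule generate_ring.incl)

lemma proj_B:
  "proj r s (scal c) \<in> Balg r s" "proj r s e1 \<in> Balg r s" "proj r s (x2 r) \<in> Balg r s" "proj r s (wt r s) \<in> Balg r s"
  by (rule B_incl; simp add: B_gens_def X1_def X2_def Wtilde_def wt_def)+

lemma proj_B_mult: "proj r s p \<in> Balg r s \<Longrightarrow> proj r s q \<in> Balg r s \<Longrightarrow> proj r s (p * q) \<in> Balg r s"
  and proj_B_add: "proj r s p \<in> Balg r s \<Longrightarrow> proj r s q \<in> Balg r s \<Longrightarrow> proj r s (p + q) \<in> Balg r s"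
  and proj_B_minus: "proj r s p \<in> Balg r s \<Longrightarrow> proj r s (- p) \<in> Balg r s"
  by (simp_all add: proj_ring proj_minus generate_ring.intros)

lemma proj_B_pow: "proj r s p \<in> Balg r s \<Longrightarrow> proj r s (p ^ n) \<in> Balg r s"
  by (induction n) (auto intro: proj_B_mult simp: proj_ring(3) generate_ring.one)

lemma B_proj:
  assumes "b \<in> Balg r s"
  shows "\<exists>p. b = proj r s p"
proof -
  have "b \<in> carrier (Uplus r s)"
    using assms by (rule ring.generate_ring_in_carrier[OF ring_Uplus B_gens_carrier])
  then show ?thesis
    by (auto simp: carrier_Uplus)
qed

section \<open>Normality of \<open>X\<^sub>1\<close> and denominators\<close>

context
  fixes r s :: complex
  assumes r: "r \<noteq> 0" and s: "s \<noteq> 0" and rs: "r^2 \<noteq> s^2"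
begin

lemma normal_X1:
  assumes "b \<in> Balg r s"
  shows "(\<exists>b'\<in>Balg r s. X1 r s \<otimes>\<^bsub>Uplus r s\<^esub> b = b' \<otimes>\<^bsub>Uplus r s\<^esub> X1 r s) \<and>
    (\<exists>b'\<in>Balg r s. b \<otimes>\<^bsub>Uplus r s\<^esub> X1 r s = X1 r s \<otimes>\<^bsub>Uplus r s\<^esub> b')"
proof -
  interpret U: ring "Uplus r s"
    by (rule ring_Uplus)
  have x: "X1 r s \<in> carrier (Uplus r s)"
    by (simp add: X1_def)
  have c: "b \<in> carrier (Uplus r s)" if "b \<in> Balg r s" for b
    using U.generate_ring_in_carrier[OF B_gens_carrier that] .
  show ?thesis
    using assms
  proof (induction rule: generate_ring.induct)
    case one
    then show ?case
      using x by (auto intro!: bexI[of _ "\<one>\<^bsub>Uplus r s\<^esub>"] generate_ring.one)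
  next
    case (incl g)
    then obtain q p where q: "q \<noteq> 0" "g = proj r s p"
      "proj r s (e1 * p) = proj r s (scal q * (p * e1))"
      using B_gens_q_commute[OF r s] by blast
    have pB: "proj r s (scal c * p) \<in> Balg r s" for c
      using incl q(2) B_incl proj_B by (intro proj_B_mult) auto
    have 1: "X1 r s \<otimes>\<^bsub>Uplus r s\<^esub> g = proj r s (scal q * p) \<otimes>\<^bsub>Uplus r s\<^esub> X1 r s"
      using q by (simp add: X1_def proj_ring(1)[symmetric] mult.assoc)
    \<comment> \<open>Dividing by \<open>q\<close> gives the other direction:
      \<open>e1 * (p / q)\<close> and \<open>p * e1\<close> agree in \<open>U\<close>.\<close>
    have "X1 r s \<otimes>\<^bsub>Uplus r s\<^esub> proj r s (scal (1 / q) * p)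
        = proj r s (scal (1 / q)) \<otimes>\<^bsub>Uplus r s\<^esub> proj r s (e1 * p)"
      by (simp add: X1_def proj_ring(1)[symmetric] scal_left_commute)
    also have "\<dots> = proj r s ((scal (1 / q) * scal q) * (p * e1))"
      by (simp only: q(3) proj_ring(1)[symmetric] mult.assoc)
    also have "\<dots> = g \<otimes>\<^bsub>Uplus r s\<^esub> X1 r s"
      using q(1) by (simp add: q(2) X1_def proj_ring(1)[symmetric] scal_mult[symmetric])
    finally show ?case
      using 1 pB by metis
  next
    case (a_inv b)
    then obtain b' b'' where "b' \<in> Balg r s" "X1 r s \<otimes>\<^bsub>Uplus r s\<^esub> b = b' \<otimes>\<^bsub>Uplus r s\<^esub> X1 r s"
      "b'' \<in> Balg r s" "b \<otimes>\<^bsub>Uplus r s\<^esub> X1 r s = X1 r s \<otimes>\<^bsub>Uplus r s\<^esub> b''"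
      by blast
    with x c a_inv.hyps show ?case
      by (intro conjI bexI[of _ "\<ominus>\<^bsub>Uplus r s\<^esub> b'"] bexI[of _ "\<ominus>\<^bsub>Uplus r s\<^esub> b''"])
        (simp_all add: U.l_minus U.r_minus generate_ring.a_inv)
  next
    case (eng_add a b)
    obtain a' a'' where "a' \<in> Balg r s" "X1 r s \<otimes>\<^bsub>Uplus r s\<^esub> a = a' \<otimes>\<^bsub>Uplus r s\<^esub> X1 r s"
      "a'' \<in> Balg r s" "a \<otimes>\<^bsub>Uplus r s\<^esub> X1 r s = X1 r s \<otimes>\<^bsub>Uplus r s\<^esub> a''"
      using eng_add.IH(1) by blast
    moreover obtain b' b'' where "b' \<in> Balg r s" "X1 r s \<otimes>\<^bsub>Uplus r s\<^esub> b = b' \<otimes>\<^bsub>Uplus r s\<^esub> X1 r s"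
      "b'' \<in> Balg r s" "b \<otimes>\<^bsub>Uplus r s\<^esub> X1 r s = X1 r s \<otimes>\<^bsub>Uplus r s\<^esub> b''"
      using eng_add.IH(2) by blast
    ultimately show ?case
      using x c eng_add.hyps
      by (intro conjI bexI[of _ "a' \<oplus>\<^bsub>Uplus r s\<^esub> b'"] bexI[of _ "a'' \<oplus>\<^bsub>Uplus r s\<^esub> b''"])
        (simp_all add: U.l_distr U.r_distr generate_ring.eng_add)
  next
    case (eng_mult a b)
    obtain a' a'' where a: "a' \<in> Balg r s" "X1 r s \<otimes>\<^bsub>Uplus r s\<^esub> a = a' \<otimes>\<^bsub>Uplus r s\<^esub> X1 r s"
      "a'' \<in> Balg r s" "a \<otimes>\<^bsub>Uplus r s\<^esub> X1 r s = X1 r s \<otimes>\<^bsub>Uplus r s\<^esub> a''"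
      using eng_mult.IH(1) by blast
    obtain b' b'' where b: "b' \<in> Balg r s" "X1 r s \<otimes>\<^bsub>Uplus r s\<^esub> b = b' \<otimes>\<^bsub>Uplus r s\<^esub> X1 r s"
      "b'' \<in> Balg r s" "b \<otimes>\<^bsub>Uplus r s\<^esub> X1 r s = X1 r s \<otimes>\<^bsub>Uplus r s\<^esub> b''"
      using eng_mult.IH(2) by blast
    note cs = x c[OF eng_mult.hyps(1)] c[OF eng_mult.hyps(2)] c[OF a(1)] c[OF a(3)] c[OF b(1)] c[OF b(3)]
    have "X1 r s \<otimes>\<^bsub>Uplus r s\<^esub> (a \<otimes>\<^bsub>Uplus r s\<^esub> b) = a' \<otimes>\<^bsub>Uplus r s\<^esub> (X1 r s \<otimes>\<^bsub>Uplus r s\<^esub> b)"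
      using cs a(2) by (metis U.m_assoc)
    also have "\<dots> = (a' \<otimes>\<^bsub>Uplus r s\<^esub> b') \<otimes>\<^bsub>Uplus r s\<^esub> X1 r s"
      using cs b(2) by (simp add: U.m_assoc)
    finally have 1: "X1 r s \<otimes>\<^bsub>Uplus r s\<^esub> (a \<otimes>\<^bsub>Uplus r s\<^esub> b) = (a' \<otimes>\<^bsub>Uplus r s\<^esub> b') \<otimes>\<^bsub>Uplus r s\<^esub> X1 r s" .
    have "(a \<otimes>\<^bsub>Uplus r s\<^esub> b) \<otimes>\<^bsub>Uplus r s\<^esub> X1 r s = (a \<otimes>\<^bsub>Uplus r s\<^esub> X1 r s) \<otimes>\<^bsub>Uplus r s\<^esub> b''"
      using cs b(4) by (simp add: U.m_assoc)
    also have "\<dots> = X1 r s \<otimes>\<^bsub>Uplus r s\<^esub> (a'' \<otimes>\<^bsub>Uplus r s\<^esub> b'')"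
      using cs a(4) by (simp add: U.m_assoc)
    finally have 2: "(a \<otimes>\<^bsub>Uplus r s\<^esub> b) \<otimes>\<^bsub>Uplus r s\<^esub> X1 r s = X1 r s \<otimes>\<^bsub>Uplus r s\<^esub> (a'' \<otimes>\<^bsub>Uplus r s\<^esub> b'')" .
    show ?case
    proof (intro conjI bexI)
      show "a' \<otimes>\<^bsub>Uplus r s\<^esub> b' \<in> Balg r s" "a'' \<otimes>\<^bsub>Uplus r s\<^esub> b'' \<in> Balg r s"
        using a b by (simp_all add: generate_ring.eng_mult)
    qed (rule 1 2)+
  qed
qed

lemma e2_e1_B: "proj r s (e2 * e1) \<in> Balg r s"
proof -
  have "e2 * e1 = scal (1 / (r^2 - s^2)) * (wt r s + - x2 r)"
    using e2_e1[OF rs] by simp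
  then show ?thesis
    using proj_B proj_B_mult proj_B_add proj_B_minus by metis
qed

text \<open>A new letter \<open>e2\<close> costs one more power of \<open>e1\<close>: by normality
  \<open>p * e1^(k + 1)\<close> equals \<open>e1 * q\<close> in \<open>U\<close> with
  \<open>q\<close> in the subalgebra, and \<open>e2 * e1\<close> lies there too.\<close>

lemma denominator_X1: "\<exists>k::nat. proj r s (p * e1 ^ k) \<in> Balg r s"
proof (induction p rule: free_alg_induct)
  case (scal c)
  then show ?case
    by (intro exI[of _ 0]) (simp add: proj_B(1))
next
  case (add p q)
  then obtain k l where "proj r s (p * e1 ^ k) \<in> Balg r s" "proj r s (q * e1 ^ l) \<in> Balg r s"
    by blast
  then have "proj r s ((p * e1 ^ k) * e1 ^ l + (q * e1 ^ l) * e1 ^ k) \<in> Balg r s"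
    by (rule proj_B_add[OF proj_B_mult[OF _ proj_B_pow[OF proj_B(2)]]
          proj_B_mult[OF _ proj_B_pow[OF proj_B(2)]]])
  moreover have "(p * e1 ^ k) * e1 ^ l + (q * e1 ^ l) * e1 ^ k = (p + q) * e1 ^ (k + l)"
    by (simp add: distrib_right mult.assoc power_add[symmetric] add.commute)
  ultimately show ?case
    by metis
next
  case (e1 p)
  then obtain k where "proj r s (p * e1 ^ k) \<in> Balg r s"
    by blast
  then have "proj r s (e1 * (p * e1 ^ k)) \<in> Balg r s"
    by (rule proj_B_mult[OF proj_B(2)])
  then show ?case
    by (auto simp: mult.assoc)
next
  case (e2 p)
  then obtain k where k: "proj r s (p * e1 ^ k) \<in> Balg r s"
    by blast
  then obtain q where q: "proj r s q \<in> Balg r s" "proj r s (p * e1 ^ k) \<otimes>\<^bsub>Uplus r s\<^esub> X1 r s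
      = X1 r s \<otimes>\<^bsub>Uplus r s\<^esub> proj r s q"
    using normal_X1[OF k] B_proj by blast
  have "proj r s (e2 * p * e1 ^ Suc k) = proj r s e2 \<otimes>\<^bsub>Uplus r s\<^esub> proj r s ((p * e1 ^ k) * e1)"
    by (simp add: proj_ring(1)[symmetric] mult.assoc power_commutes)
  also have "proj r s ((p * e1 ^ k) * e1) = proj r s (e1 * q)"
    using q(2) by (simp add: X1_def proj_ring(1))
  also have "proj r s e2 \<otimes>\<^bsub>Uplus r s\<^esub> proj r s (e1 * q) = proj r s ((e2 * e1) * q)"
    by (simp add: proj_ring(1)[symmetric] mult.assoc)
  also have "\<dots> \<in> Balg r s"
    using q(1) e2_e1_B by (rule proj_B_mult[rotated])
  finally show ?case ..
qed

lemma ore_pair_X1: "ore_pair (Uplus r s) (Balg r s) (X1 r s)"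
proof (intro ore_pair.intro ore_pair_axioms.intro ring_Uplus)
  show "subring (Balg r s) (Uplus r s)"
    by (rule ring.generate_ring_is_subring[OF ring_Uplus B_gens_carrier])
  show "X1 r s \<in> Balg r s"
    unfolding X1_def by (rule proj_B)
  show "\<exists>k::nat. u \<otimes>\<^bsub>Uplus r s\<^esub> X1 r s [^]\<^bsub>Uplus r s\<^esub> k \<in> Balg r s" if "u \<in> carrier (Uplus r s)" for u
    using that denominator_X1 by (auto simp: carrier_Uplus X1_def proj_ring(1)[symmetric] proj_pow[symmetric])
qed (use normal_X1 in blast)+

end

section \<open>Powers of \<open>X\<^sub>1\<close> at roots of unity\<close>

lemma pow_q_commute:
  assumes "proj r s (z * g) = proj r s (scal q * (g * z))"
  shows "proj r s (z ^ n * g) = proj r s (scal (q ^ n) * (g * z ^ n))"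
proof (induction n)
  case 0
  then show ?case by simp
next
  case (Suc n)
  have "proj r s (z ^ Suc n * g) = proj r s (z ^ n) \<otimes>\<^bsub>Uplus r s\<^esub> proj r s (z * g)"
    by (simp add: proj_ring(1)[symmetric] power_Suc2 mult.assoc del: power_Suc)
  also have "\<dots> = proj r s (scal q) \<otimes>\<^bsub>Uplus r s\<^esub> proj r s (z ^ n * g) \<otimes>\<^bsub>Uplus r s\<^esub> proj r s z"
    unfolding assms by (simp add: proj_ring(1)[symmetric] mult.assoc scal_left_commute)
  also have "\<dots> = proj r s (scal (q ^ Suc n) * (g * z ^ Suc n))"
    unfolding Suc by (simp add: proj_ring(1)[symmetric] mult.assoc scal_mult power_Suc2
        scal_left_commute[of "scal a" for a] del: power_Suc)
  finally show ?case .
qed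

context simple_Uplus_module
begin

text \<open>The power \<open>z = e1^n\<close> commutes in \<open>U\<close> with
  \<open>X\<^sub>2\<close> and \<open>Wtilde\<close>, hence with \<open>X\<^sub>4 X\<^sub>1\<close>.
  So \<open>(z * e2 - e2 * z) * e1\<close> acts as zero, and torsionfreeness removes the last
  factor. Commutation with \<open>e2\<close> is thus obtained on \<open>M\<close>.\<close>

lemma e1_pow_central:
  assumes rs: "r^2 \<noteq> s^2" and n: "r ^ n = 1" "s ^ n = 1"
    and tf: "torsionfree_wrt (Uplus r s) (X1 r s) M"
    and v: "v \<in> carrier M"
  shows "act v (e1 ^ n * p) = act v (p * e1 ^ n)"
  using v
proof (induction p arbitrary: v rule: free_alg_induct)
  case (scal c)
  then show ?case by (simp add: scal_central)
next
  case (add p q)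
  then show ?case by (simp add: distrib_left distrib_right act_add)
next
  case (e1 p)
  have "act v (e1 ^ n * (e1 * p)) = act (act v e1) (e1 ^ n * p)"
    using e1.prems by (simp add: act_mult[symmetric] mult.assoc[symmetric] power_commutes)
  also have "\<dots> = act v (e1 * p * e1 ^ n)"
    using e1 by (simp add: act_mult[symmetric] mult.assoc)
  finally show ?case .
next
  case (e2 p)
  let ?z = "e1 ^ n"
  have q: "(s^2) ^ n = 1" "(r^2) ^ n = 1"
    using n by (simp_all add: power_mult[symmetric] mult.commute[of 2] power_mult)
  have "proj r s (?z * x2 r) = proj r s (x2 r * ?z)"
    using pow_q_commute[OF proj_e1_x2, where n = n] q by simp
  then have x2: "act v (?z * x2 r) = act v (x2 r * ?z)"
    by simp
  have "proj r s (?z * wt r s) = proj r s (wt r s * ?z)"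
    using pow_q_commute[OF proj_e1_wt, where n = n] q by simp
  then have wt: "act v (?z * wt r s) = act v (wt r s * ?z)"
    by simp
  have "act v ((?z * wt r s - wt r s * ?z) - (?z * x2 r - x2 r * ?z)) = \<zero>\<^bsub>M\<^esub>"
    using e2.prems x2 wt act_diff_eq_zero by metis
  then have "act v (scal (1 / (r^2 - s^2)) * ((?z * wt r s - wt r s * ?z) - (?z * x2 r - x2 r * ?z))) = \<zero>\<^bsub>M\<^esub>"
    using e2.prems by (intro act_scal_mult_eq_zero)
  moreover have "scal (1 / (r^2 - s^2)) * ((?z * wt r s - wt r s * ?z) - (?z * x2 r - x2 r * ?z))
      = ?z * (e2 * e1) - (e2 * e1) * ?z"
    unfolding e2_e1[OF rs] by (simp add: algebra_simps scal_left_commute)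
  \<comment> \<open>The exponent 1 is spelled out to match torsionfreeness, which speaks of
    powers.\<close>
  moreover have "\<dots> = (?z * e2 - e2 * ?z) * e1 ^ 1"
    by (simp add: left_diff_distrib mult.assoc power_commutes)
  ultimately have "act (act v (?z * e2 - e2 * ?z)) (e1 ^ 1) = \<zero>\<^bsub>M\<^esub>"
    using e2.prems act_mult by metis
  then have "act v (?z * e2 - e2 * ?z) = \<zero>\<^bsub>M\<^esub>"
    using tf act_closed[OF e2.prems] unfolding torsionfree_wrt_def X1_def proj_pow[symmetric] by blast
  then have ze2: "act v (?z * e2) = act v (e2 * ?z)"
    using e2.prems act_diff_eq_zero by blast
  have "act v (?z * (e2 * p)) = act (act v (e2 * ?z)) p"
    using e2.prems by (simp add: ze2[symmetric] act_mult[symmetric] mult.assoc)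
  also have "\<dots> = act (act v e2) (?z * p)"
    using e2.prems by (simp add: act_mult[symmetric] mult.assoc)
  also have "\<dots> = act v (e2 * p * ?z)"
    using e2 by (simp add: act_mult[symmetric] mult.assoc)
  finally show ?case .
qed

text \<open>By Schur's lemma \<open>e1^n\<close> acts as a scalar \<open>c\<close>. As
  \<open>k + (n - 1) * k = n * k\<close>, the inverse of \<open>e1^k\<close> is
  \<open>e1^((n - 1) * k)\<close> divided by \<open>c^k\<close>, an element built from
  \<open>X\<^sub>1\<close> and scalars.\<close>

lemma X1_pow_invertible:
  assumes rs: "r^2 \<noteq> s^2" and n: "n > 0" "r ^ n = 1" "s ^ n = 1"
    and tf: "torsionfree_wrt (Uplus r s) (X1 r s) M"
  shows "\<exists>c. \<forall>v\<in>carrier M. act v (e1 ^ k * (scal c * e1 ^ ((n - 1) * k))) = v"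
proof -
  obtain c where c: "\<And>v. v \<in> carrier M \<Longrightarrow> act v (e1 ^ n) = act v (scal c)"
    using central_acts_as_scalar[of "e1 ^ n"] e1_pow_central[OF rs n(2,3) tf] by blast
  \<comment> \<open>Otherwise a power of \<open>X\<^sub>1\<close> would kill the nonzero module
    \<open>M\<close>.\<close>
  have "c \<noteq> 0"
  proof
    assume "c = 0"
    then have "act v (e1 ^ n) = \<zero>\<^bsub>M\<^esub>" if "v \<in> carrier M" for v
      using c that by (simp add: act_0)
    then have "v = \<zero>\<^bsub>M\<^esub>" if "v \<in> carrier M" for v
      using that tf unfolding torsionfree_wrt_def X1_def proj_pow[symmetric] by blast
    then show False
      using simple M.zero_closed unfolding simple_right_module_def by blast
  qed
  have pow: "act v ((e1 ^ n) ^ k) = act v (scal (c ^ k))" if v: "v \<in> carrier M" for v k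
    using v
  proof (induction k arbitrary: v)
    case (Suc k)
    then have "act v ((e1 ^ n) ^ Suc k) = act (act v (scal c)) (scal (c ^ k))"
      by (simp add: act_mult c del: power_mult)
    then show ?case
      using Suc.prems by (simp add: act_mult[symmetric] scal_mult)
  qed simp
  have "act v (e1 ^ k * (scal (1 / c ^ k) * e1 ^ ((n - 1) * k))) = v" if v: "v \<in> carrier M" for v
  proof -
    have "k + (n - 1) * k = n * k"
      using n(1) by (cases n) simp_all
    then have "e1 ^ k * (scal (1 / c ^ k) * e1 ^ ((n - 1) * k)) = scal (1 / c ^ k) * (e1 ^ n) ^ k"
      by (simp only: scal_left_commute power_add[symmetric] power_mult[symmetric])
    then have "act v (e1 ^ k * (scal (1 / c ^ k) * e1 ^ ((n - 1) * k)))
        = act (act v (scal (1 / c ^ k))) (scal (c ^ k))"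
      using v pow by (simp only: act_mult act_closed)
    also have "\<dots> = act v (scal (1 / c ^ k * c ^ k))"
      using v by (simp only: act_mult scal_mult)
    finally show ?thesis
      using \<open>c \<noteq> 0\<close> v by (simp add: act_1)
  qed
  then show ?thesis by blast
qed

end

section \<open>The correspondence of simple torsionfree modules\<close>

theorem theorem4p10:
  fixes r s :: complex
  assumes "r \<noteq> 0" and "s \<noteq> 0"
    and "\<exists>m::nat. m > 0 \<and> r ^ m = 1"
    and "\<exists>n::nat. n > 0 \<and> s ^ n = 1"
    and "r^2 \<noteq> s^2"
  shows "\<exists>\<Phi>. bij_betw \<Phi>
      ((simple_tf (Uplus r s) (X1 r s) :: (free_alg set, 'v) right_module set)
         // iso_rel (Uplus r s) (X1 r s))
      ((simple_tf (Bsub r s) (X1 r s) :: (free_alg set, 'v) right_module set)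
         // iso_rel (Bsub r s) (X1 r s))
    \<and> (\<forall>M \<in> simple_tf (Uplus r s) (X1 r s).
         \<Phi> (iso_rel (Uplus r s) (X1 r s) `` {M}) = iso_rel (Bsub r s) (X1 r s) `` {M})"
  unfolding Bsub_eq
proof (rule ore_pair.iso_classes_bij[OF ore_pair_X1[OF assms(1,2,5)]])
  fix M :: "(free_alg set, 'v) right_module" and k :: nat
  assume M: "M \<in> simple_tf (Uplus r s) (X1 r s)"
  interpret simple_Uplus_module r s M
    using M simple_tfD(1)[OF M]
    by (intro simple_Uplus_module.intro Uplus_module.intro simple_Uplus_module_axioms.intro)
      (simp_all add: simple_tf_def)
  obtain m l :: nat where ml: "m > 0" "r ^ m = 1" "l > 0" "s ^ l = 1"
    using assms(3,4) by blast
  \<comment> \<open>A common exponent is needed so that one power of \<open>X\<^sub>1\<close>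
    commutes with both \<open>X\<^sub>2\<close> and \<open>Wtilde\<close>.\<close>
  have "r ^ (m * l) = (r ^ m) ^ l" "s ^ (m * l) = (s ^ l) ^ m"
    by (simp_all add: power_mult[symmetric] mult.commute)
  with ml have n: "m * l > 0" "r ^ (m * l) = 1" "s ^ (m * l) = 1"
    by simp_all
  obtain c where c: "\<forall>v\<in>carrier M. act v (e1 ^ k * (scal c * e1 ^ ((m * l - 1) * k))) = v"
    using X1_pow_invertible[OF assms(5) n simple_tfD(3)[OF M]] by blast
  show "\<exists>y\<in>generate_ring (Uplus r s) (B_gens r s).
      \<forall>v\<in>carrier M. v \<triangleleft>\<^bsub>M\<^esub> (X1 r s [^]\<^bsub>Uplus r s\<^esub> k \<otimes>\<^bsub>Uplus r s\<^esub> y) = v"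
  proof
    show "proj r s (scal c * e1 ^ ((m * l - 1) * k)) \<in> generate_ring (Uplus r s) (B_gens r s)"
      by (intro proj_B_mult proj_B_pow proj_B)
    show "\<forall>v\<in>carrier M. v \<triangleleft>\<^bsub>M\<^esub> (X1 r s [^]\<^bsub>Uplus r s\<^esub> k
        \<otimes>\<^bsub>Uplus r s\<^esub> proj r s (scal c * e1 ^ ((m * l - 1) * k))) = v"
      using c by (simp add: X1_def proj_pow[symmetric] proj_ring(1)[symmetric])
  qed
qed


end
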